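(* Let $D\subset\mathbb{R}^2$ be a bounded simply connected domain with $C^1$ boundary and barycenter at the origin. Assume that $\chi_D$ is a V-state with angular velocity $\Omega=\frac12$, i.e. there is a constant $\mu\in\mathbb{R}$ with $$\psi(x)-\tfrac14|x|^2=\mu\quad\text{for all }x\in\partial D,\qquad \psi(x)=\frac1{2\pi}\int_D\log|x-y|\,dy .$$ Then $D$ is a disc.
   Context: A V-state (rotating patch) for the 2D incompressible Euler equations is a domain $D$ such that the vortex patch $\omega_0=\chi_D$ evolves as $\omega(t)=\chi_{D_t}$ with $D_t$ the rotation of $D$ about its barycenter (taken to be $0$) by angle $\Omega t$; for a $C^1$ boundary this is equivalent to the condition that $\psi(x)-\frac12\Omega|x|^2$ is constant on $\partial D$, where $\psi$ is the stream function of $\chi_D$ given in the claim. *)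

theory Defs
  imports "HOL-Analysis.Analysis"
begin

text \<open>We identify the plane R^2 with the complex numbers; Lebesgue measure on complex
  is the planar Lebesgue measure.\<close>

definition stream_fun :: "complex set \<Rightarrow> complex \<Rightarrow> real" where
  "stream_fun D x = (1 / (2 * pi)) * integral D (\<lambda>y. ln (norm (x - y)))"

text \<open>C^1 boundary (standard local-graph definition): near every boundary point p,
  after a rigid motion (translation to p and a rotation), D coincides with the region
  strictly below the graph of a C^1 function f : R \<Rightarrow> R.\<close>
definition C1_boundary :: "complex set \<Rightarrow> bool" where
  "C1_boundary D \<longleftrightarrow>
     (\<forall>p \<in> frontier D. \<exists>r > 0. \<exists>\<theta> :: real. \<exists>f :: real \<Rightarrow> real.
        f C1_differentiable_on UNIV \<and> f 0 = 0 \<and>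
        D \<inter> ball p r = {x \<in> ball p r. Im (cis \<theta> * (x - p)) < f (Re (cis \<theta> * (x - p)))})"

definition barycenter_zero :: "complex set \<Rightarrow> bool" where
  "barycenter_zero D \<longleftrightarrow> integral D (\<lambda>y. y) = 0"

end

theory Submission
  imports Defs "HOL-Complex_Analysis.Complex_Analysis"
begin

text \<open>
  Since \<open>\<psi>\<close> and \<open>|x|\<^sup>2/4\<close> both have Laplacian 1 in \<open>D\<close>, their difference is harmonic there and constant on
  the boundary, hence constant. Taking gradients, the Cauchy transform
  \<open>F z = \<integral>\<^sub>D dy / (z - y)\<close> equals \<open>\<pi> cnj z\<close> on \<open>D\<close> and, by continuity, on its closure. Outside the
  closure the function \<open>G z = z F z\<close> is holomorphic, it takes the real values \<open>\<pi> |z|\<^sup>2\<close> on the boundary, and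
  it tends to the area of \<open>D\<close> at infinity. So its imaginary part vanishes and \<open>G\<close> is the area of \<open>D\<close>
  far out. At a point of the closure of maximal modulus \<open>M\<close> this gives area \<open>\<pi> M\<^sup>2\<close>: \<open>D\<close> is a subset of
  full measure of the disc of radius \<open>M\<close>, and the regularity of its boundary makes it the whole disc.
\<close>

section \<open>Lebesgue measure on the complex plane\<close>

text \<open>The value 1/2 is the one for which the Laplacians 1 of the stream function and 2 * Omega
  of the quadratic term cancel. Second derivatives of the potential are never formed. Instead
  \<open>F z - pi * cnj z\<close> is shown to be holomorphic by cutting out a small disc, whose
  Cauchy transform is known exactly, and it is recognised as the complex form of the gradient of 2 *
  pi * (psi - |x|^2/4). Harmonic functions are likewise replaced by real parts of holomorphic ones:
  simple connectivity supplies a primitive, and the maximum modulus principle is applied to its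
  exponential. The factor \<open>z\<close> in \<open>G\<close> has two effects: it turns
  \<open>pi * cnj z\<close> into a real function, and it makes the limit at infinity the total mass
  instead of 0. The recurrent obstacle is that the kernels are singular at points where the
  potentials are evaluated, so continuity and differentiation have to be obtained without a
  dominating function for the raw kernel.\<close>

lemma emeasure_ball_complex:
  "r \<ge> 0 \<Longrightarrow> emeasure lborel (ball (c::complex) r) = ennreal (pi * r\<^sup>2)"
  by (simp add: emeasure_ball unit_ball_vol_2)

text \<open>Dyadic shells: at distance between R/2^(k+1) and R/2^k from \<open>c\<close> the
  integrand is at most 2^(k+1)/R, and the disc of radius R/2^k has area pi * R^2/4^k. The products
  form a geometric series with sum 4 * pi * R, twice the exact value, which is good enough since
  only the order in \<open>R\<close> matters.\<close>

lemma nn_integral_inverse_dist_ball: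
  fixes c :: complex
  assumes "R > 0"
  shows "(\<integral>\<^sup>+y. ennreal (indicator (ball c R) y * inverse (norm (c - y))) \<partial>lborel) \<le> ennreal (4 * pi * R)"
proof -
  let ?t = "\<lambda>k y. ennreal (2 ^ (k+1) / R) * indicator (ball c (R / 2 ^ k)) y"
  have pt: "ennreal (indicator (ball c R) y * inverse (norm (c - y))) \<le> (\<Sum>k. ?t k y)" for y
  proof (cases "y \<in> ball c R \<and> y \<noteq> c")
    case True
    define d where "d = dist c y"
    have d: "0 < d" "d < R" using True by (auto simp: d_def)
    have "\<exists>k. R / 2 ^ k \<le> d"
    proof -
      obtain n where "(1/2::real) ^ n < d / R"
        using real_arch_pow_inv[of "d/R" "1/2"] d assms by auto
      then have "R / 2 ^ n \<le> d" using assms by (simp add: field_simps power_divide)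
      then show ?thesis ..
    qed
    \<comment> \<open>\<open>m\<close> is the first dyadic radius not exceeding \<open>d\<close>. It
      is positive because \<open>d < R\<close>, so its predecessor \<open>k\<close> indexes the
      shell containing \<open>y\<close>.\<close>
    define m where "m = (LEAST k. R / 2 ^ k \<le> d)"
    have m: "R / 2 ^ m \<le> d" unfolding m_def by (rule LeastI_ex) fact
    have "m \<noteq> 0" using m d by (cases m) auto
    then obtain k where k: "m = Suc k" by (cases m) auto
    have "\<not> R / 2 ^ k \<le> d" using not_less_Least[of k "\<lambda>k. R / 2 ^ k \<le> d"] k m_def by auto
    then have kk: "d < R / 2 ^ k" by simp
    have "inverse d \<le> 2 ^ (k+1) / R" using m k assms d by (simp add: field_simps)
    then have "ennreal (indicator (ball c R) y * inverse (norm (c - y))) \<le> ?t k y"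
      using True kk by (auto simp: d_def dist_norm intro!: ennreal_leI)
    also have "\<dots> \<le> (\<Sum>k. ?t k y)"
    proof -
      have "f k \<le> suminf f" for f :: "nat \<Rightarrow> ennreal"
        using sum_le_suminf[of f "{k}"] by simp
      then show ?thesis .
    qed
    finally show ?thesis .
  qed (auto simp: indicator_def)
  have "(\<integral>\<^sup>+y. ennreal (indicator (ball c R) y * inverse (norm (c - y))) \<partial>lborel) \<le> (\<integral>\<^sup>+y. (\<Sum>k. ?t k y) \<partial>lborel)"
    by (intro nn_integral_mono pt)
  also have "\<dots> = (\<Sum>k. \<integral>\<^sup>+y. ?t k y \<partial>lborel)"
  proof (intro nn_integral_suminf)
    have [measurable]: "ball c r \<in> sets borel" for r by simp
    show "?t k \<in> borel_measurable lborel" for k by measurable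
  qed
  also have "\<dots> = (\<Sum>k. ennreal (2 * pi * R * (1/2) ^ k))"
  proof (intro suminf_cong)
    fix k
    have "(\<integral>\<^sup>+y. ?t k y \<partial>lborel) = ennreal (2 ^ (k+1) / R) * ennreal (pi * (R / 2 ^ k)\<^sup>2)"
      using assms by (simp add: nn_integral_cmult_indicator emeasure_ball_complex)
    also have "\<dots> = ennreal (2 ^ (k+1) / R * (pi * (R / 2 ^ k)\<^sup>2))"
      using assms by (intro ennreal_mult[symmetric]) auto
    also have "2 ^ (k+1) / R * (pi * (R / 2 ^ k)\<^sup>2) = 2 * pi * R * (1/2) ^ k"
      using assms by (simp add: field_simps power2_eq_square power_divide)
    finally show "(\<integral>\<^sup>+y. ?t k y \<partial>lborel) = ennreal (2 * pi * R * (1/2) ^ k)" .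
  qed
  also have "\<dots> = ennreal (4 * pi * R)"
  proof (rule suminf_ennreal_eq)
    have "(\<lambda>k. (1/2::real) ^ k) sums 2" using geometric_sums[of "1/2::real"] by simp
    from sums_mult[OF this, of "2*pi*R"] show "(\<lambda>k. 2 * pi * R * (1/2) ^ k) sums (4 * pi * R)" by (simp add: mult.assoc)
  qed (use assms in auto)
  finally show ?thesis .
qed

lemma integrable_inverse_dist_ball:
  fixes c :: complex
  assumes "R > 0"
  shows "integrable lborel (\<lambda>y. indicator (ball c R) y * inverse (norm (c - y)))"
    and "(\<integral>y. indicator (ball c R) y * inverse (norm (c - y)) \<partial>lborel) \<le> 4 * pi * R"
proof -
  note nn = nn_integral_inverse_dist_ball[OF assms, of c]
  show i: "integrable lborel (\<lambda>y. indicator (ball c R) y * inverse (norm (c - y)))"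
  proof (rule integrableI_bounded)
    show "(\<integral>\<^sup>+y. ennreal (norm (indicator (ball c R) y * inverse (norm (c - y)))) \<partial>lborel) < \<infinity>"
      using nn by (simp add: le_less_trans[OF nn])
  next
    have [measurable]: "ball c R \<in> sets borel" by simp
    show "(\<lambda>y. indicator (ball c R) y * inverse (norm (c - y))) \<in> borel_measurable lborel" by measurable
  qed
  have "ennreal (\<integral>y. indicator (ball c R) y * inverse (norm (c - y)) \<partial>lborel) \<le> ennreal (4 * pi * R)"
    by (subst nn_integral_eq_integral[OF i, symmetric]) (use nn in auto)
  then show "(\<integral>y. indicator (ball c R) y * inverse (norm (c - y)) \<partial>lborel) \<le> 4 * pi * R"
    using assms by simp
qed

text \<open>Transfers the invariance of Lebesgue measure under orthogonal maps, which the library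
  has only for \<open>real ^ 'n\<close>, to the complex plane.\<close>
lemma lborel_distr_vec2_complex:
  "distr lborel borel (\<lambda>v::real^2. Complex (vec_nth v 1) (vec_nth v 2)) = lborel"
proof -
  have meas: "(\<lambda>v::real^2. Complex (vec_nth v 1) (vec_nth v 2)) \<in> borel_measurable borel"
    by (intro borel_measurable_continuous_onI continuous_intros)
  show ?thesis
  proof (rule lborel_eqI[symmetric])
    fix l u :: complex
    assume le: "\<And>b. b \<in> Basis \<Longrightarrow> l \<bullet> b \<le> u \<bullet> b"
    let ?w = "\<lambda>z. vector [Re z, Im z] :: real^2"
    have vim: "(\<lambda>v::real^2. Complex (vec_nth v 1) (vec_nth v 2)) -` box l u = box (?w l) (?w u)"
      by (auto simp: box_def Basis_complex_def Basis_vec_def forall_2 inner_axis)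
    have "emeasure (distr lborel borel (\<lambda>v::real^2. Complex (vec_nth v 1) (vec_nth v 2))) (box l u) = emeasure lborel (box (?w l) (?w u))"
      using meas by (subst emeasure_distr) (auto simp: vim)
    also have "\<dots> = ennreal (\<Prod>b\<in>Basis. (?w u - ?w l) \<bullet> b)"
    proof (rule emeasure_lborel_box)
      fix b :: "real^2" assume "b \<in> Basis"
      then have "b = axis 1 1 \<or> b = axis 2 1"
        by (auto simp: Basis_vec_def axis_eq_axis) (metis exhaust_2)
      then show "?w l \<bullet> b \<le> ?w u \<bullet> b"
        using le[of 1] le[of \<i>] by (auto simp: Basis_complex_def inner_axis)
    qed
    also have "(\<Prod>b\<in>Basis. (?w u - ?w l) \<bullet> b) = (\<Prod>b\<in>Basis. (u - l) \<bullet> b)"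
    proof -
      have B: "(Basis :: (real^2) set) = {axis 1 1, axis 2 1}"
        by (auto simp: Basis_vec_def UNIV_2)
      have "axis 1 (1::real) \<noteq> (axis 2 1 :: real^2)" by (simp add: axis_eq_axis)
      then show ?thesis unfolding B by (simp add: Basis_complex_def inner_axis)
    qed
    finally show "emeasure (distr lborel borel (\<lambda>v::real^2. Complex (vec_nth v 1) (vec_nth v 2))) (box l u) = ennreal (\<Prod>b\<in>Basis. (u - l) \<bullet> b)" .
  qed simp
qed

lemma lborel_distr_rotation:
  fixes w :: complex
  assumes "norm w = 1"
  shows "distr lborel borel ((*) w) = lborel"
proof -
  define \<phi> :: "real^2 \<Rightarrow> complex" where "\<phi> = (\<lambda>v. Complex (vec_nth v 1) (vec_nth v 2))"
  define \<psi> :: "complex \<Rightarrow> real^2" where "\<psi> = (\<lambda>z. vector [Re z, Im z])"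
  have inv1: "\<phi> (\<psi> z) = z" for z by (simp add: \<phi>_def \<psi>_def)
  have inv2: "\<psi> (\<phi> v) = v" for v by (simp add: \<phi>_def \<psi>_def vec_eq_iff forall_2)
  have m\<phi>: "\<phi> \<in> borel_measurable borel"
    unfolding \<phi>_def by (intro borel_measurable_continuous_onI continuous_intros)
  have em: "emeasure lborel A = emeasure lborel (\<phi> -` A)" if "A \<in> sets borel" for A
    using m\<phi> that unfolding \<phi>_def by (subst lborel_distr_vec2_complex[symmetric], subst emeasure_distr) auto
  \<comment> \<open>\<open>T\<close> rotates by \<open>cnj w\<close>, the inverse of
    \<open>w\<close>, so that its image of \<open>S\<close> is a preimage under multiplication by
    \<open>w\<close>, as the pushforward measure requires.\<close>
  define T where "T = (\<lambda>v. \<psi> (cnj w * \<phi> v))"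
  have ww: "cnj w * w = 1" "w * cnj w = 1" using assms by (simp_all add: complex_norm_square[symmetric] mult.commute)
  have nT: "norm (T v) = norm v" for v
  proof -
    have n\<psi>: "norm (\<psi> z) = norm z" for z
      by (simp add: norm_vec_def L2_set_def UNIV_2 \<psi>_def cmod_def)
    have "norm (T v) = norm (\<phi> v)" by (simp add: T_def n\<psi> norm_mult assms)
    also have "\<dots> = norm (\<psi> (\<phi> v))" by (simp add: n\<psi>)
    finally show ?thesis by (simp add: inv2)
  qed
  have lT: "linear T"
    by (rule linearI) (auto simp: T_def \<phi>_def \<psi>_def vec_eq_iff forall_2 algebra_simps)
  have oT: "orthogonal_transformation T"
    using lT nT by (simp add: orthogonal_transformation)
  show ?thesis
  proof (rule lborel_eqI[symmetric])
    fix l u :: complex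
    assume le: "\<And>b. b \<in> Basis \<Longrightarrow> l \<bullet> b \<le> u \<bullet> b"
    define S where "S = \<phi> -` box l u"
    have Sb: "S \<in> sets borel" unfolding S_def using measurable_sets[OF m\<phi>, of "box l u"] by simp
    have eS: "emeasure lborel S = emeasure lborel (box l u)"
      unfolding S_def by (intro em[symmetric]) simp
    have Sl: "S \<in> lmeasurable"
      using Sb eS by (intro fmeasurableI) (auto simp: emeasure_lborel_box_finite[unfolded infinity_ennreal_def])
    have TS: "T ` S = \<phi> -` ((*) w -` box l u)"
    proof (intro set_eqI iffI)
      fix v assume "v \<in> \<phi> -` ((*) w -` box l u)"
      then have "\<psi> (w * \<phi> v) \<in> S" "T (\<psi> (w * \<phi> v)) = v"
        by (simp_all add: S_def inv1 inv2 T_def mult.assoc[symmetric] ww)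
      then show "v \<in> T ` S" by force
    qed (auto simp: T_def S_def inv1 mult.assoc[symmetric] ww)
    have mw: "(*) w \<in> borel_measurable borel" by simp
    have wb: "(*) w -` box l u \<in> sets borel" using measurable_sets[OF mw, of "box l u"] by simp
    have TSb: "T ` S \<in> sets borel" unfolding TS using measurable_sets[OF m\<phi> wb] by simp
    have TSl: "T ` S \<in> lmeasurable" using measurable_orthogonal_image[OF oT Sl] .
    have "emeasure (distr lborel borel ((*) w)) (box l u) = emeasure lborel ((*) w -` box l u)"
      by (subst emeasure_distr) auto
    also have "\<dots> = emeasure lborel (T ` S)" unfolding TS by (rule em[OF wb])
    also have "\<dots> = emeasure lebesgue (T ` S)" using TSb by simp
    also have "\<dots> = measure lebesgue (T ` S)" using TSl by (simp add: emeasure_eq_measure2)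
    also have "\<dots> = measure lebesgue S" using measure_orthogonal_image[OF oT Sl] by simp
    also have "\<dots> = emeasure lebesgue S" using Sl by (simp add: emeasure_eq_measure2)
    also have "\<dots> = emeasure lborel (box l u)" using Sb eS by simp
    also have "\<dots> = ennreal (\<Prod>b\<in>Basis. (u - l) \<bullet> b)" using le by (rule emeasure_lborel_box)
    finally show "emeasure (distr lborel borel ((*) w)) (box l u) = ennreal (\<Prod>b\<in>Basis. (u - l) \<bullet> b)" .
  qed simp
qed

section \<open>Weakly singular potentials\<close>

text \<open>Densities more general than indicators are required because differentiating the Cauchy
  transform, and expanding it at infinity, produce new densities: \<open>g\<close> multiplied by
  \<open>inverse (z0 - y)\<close> or by \<open>y\<close>.\<close>

definition bdd_density :: "(complex \<Rightarrow> complex) \<Rightarrow> bool" where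
  "bdd_density g \<longleftrightarrow> g \<in> borel_measurable borel \<and> bounded (range g) \<and> bounded {y. g y \<noteq> 0}"

text \<open>As \<open>inverse 0 = 0\<close>, the bound forces \<open>k 0 = 0\<close>; this agrees with the junk values of
  \<open>inverse\<close> and \<open>ln\<close> at zero.\<close>
definition weak_kernel :: "(complex \<Rightarrow> complex) \<Rightarrow> bool" where
  "weak_kernel k \<longleftrightarrow> continuous_on (- {0}) k \<and> (\<exists>C. \<forall>w. norm (k w) \<le> C * (inverse (norm w) + norm w))"

text \<open>One framework for the logarithmic potential, the Cauchy transform and the potential of
  1/|w|, so that integrability and continuity are proved once.\<close>

definition potential :: "(complex \<Rightarrow> complex) \<Rightarrow> (complex \<Rightarrow> complex) \<Rightarrow> complex \<Rightarrow> complex" where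
  "potential k g z = (LINT y|lborel. k (z - y) * g y)"

lemma bdd_densityE:
  assumes "bdd_density g"
  obtains B M where "B > 0" "M > 0" "\<And>y. norm (g y) \<le> B * indicator (ball 0 M) y"
proof -
  obtain B where B: "B > 0" "\<And>y. norm (g y) \<le> B"
    using assms unfolding bdd_density_def bounded_pos by auto
  obtain M where M: "M > 0" "\<And>y. g y \<noteq> 0 \<Longrightarrow> norm y \<le> M"
    using assms unfolding bdd_density_def bounded_pos by auto
  have "norm (g y) \<le> B * indicator (ball 0 (M + 1)) y" for y
    using B(2)[of y] M(2)[of y] by (cases "g y = 0") (auto simp: indicator_def)
  with B(1) M(1) show ?thesis by (intro that[of B "M + 1"]) auto
qed

lemma weak_kernelE:
  assumes "weak_kernel k"
  obtains C where "C \<ge> 0" "\<And>w. norm (k w) \<le> C * (inverse (norm w) + norm w)"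
proof -
  obtain C where C: "\<And>w. norm (k w) \<le> C * (inverse (norm w) + norm w)"
    using assms unfolding weak_kernel_def by auto
  have "C \<ge> 0" using order_trans[OF norm_ge_zero C[of 1]] by simp
  with C show ?thesis using that by blast
qed

lemma weak_kernel_measurable:
  assumes "weak_kernel k"
  shows "k \<in> borel_measurable borel"
proof -
  have "(\<lambda>w. indicator (-{0}) w *\<^sub>R k w) \<in> borel_measurable borel"
    using assms unfolding weak_kernel_def by (intro borel_measurable_continuous_on_indicator) auto
  also have "(\<lambda>w. indicator (-{0}) w *\<^sub>R k w) = k"
  proof
    fix w
    have "k 0 = 0" using assms unfolding weak_kernel_def by (auto dest!: spec[of _ 0])
    then show "indicator (-{0}) w *\<^sub>R k w = k w" by (simp add: indicator_def)
  qed
  finally show ?thesis .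
qed

lemma integrable_potential:
  assumes k: "weak_kernel k" and g: "bdd_density g"
  shows "integrable lborel (\<lambda>y. k (z - y) * g y)"
proof -
  obtain B M where B: "B > 0" "M > 0" "\<And>y. norm (g y) \<le> B * indicator (ball 0 M) y"
    using bdd_densityE[OF g] by blast
  obtain C where C: "C \<ge> 0" "\<And>w. norm (k w) \<le> C * (inverse (norm w) + norm w)"
    using weak_kernelE[OF k] by blast
  have [measurable]: "k \<in> borel_measurable borel" "g \<in> borel_measurable borel"
    using weak_kernel_measurable[OF k] g by (auto simp: bdd_density_def)
  \<comment> \<open>The disc of radius \<open>N\<close> about \<open>z\<close> contains the disc of
    radius \<open>M\<close> about 0 that carries the density, so the bound for 1/|z - y| on discs
    centred at the singularity applies.\<close>
  define N where "N = M + norm z"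
  have N: "N > 0" using B by (simp add: N_def add_pos_nonneg)
  let ?h = "\<lambda>y. C * B * (indicator (ball z N) y * inverse (norm (z - y))) + C * B * N * indicator (ball z N) y"
  show ?thesis
  proof (rule Bochner_Integration.integrable_bound)
    show "integrable lborel ?h"
      by (intro Bochner_Integration.integrable_add integrable_mult_right integrable_inverse_dist_ball N integrable_real_indicator)
         (auto simp: emeasure_lborel_ball_finite[unfolded infinity_ennreal_def])
    show "AE y in lborel. norm (k (z - y) * g y) \<le> norm (?h y)"
    proof (intro AE_I2)
      fix y
      show "norm (k (z - y) * g y) \<le> norm (?h y)"
      proof (cases "y \<in> ball 0 M")
        case True
        then have lt: "norm (z - y) < N" unfolding N_def using norm_triangle_ineq4[of z y] by auto
        have "norm (k (z - y) * g y) \<le> (C * (inverse (norm (z - y)) + norm (z - y))) * B"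
          unfolding norm_mult using B(3)[of y] C True by (intro mult_mono C(2)) auto
        also have "\<dots> \<le> (C * (inverse (norm (z - y)) + N)) * B"
          using B C lt by (intro mult_right_mono mult_left_mono add_left_mono) auto
        also have "\<dots> = ?h y" using lt by (simp add: dist_norm algebra_simps)
        finally show ?thesis by simp
      next
        case False
        then have "g y = 0" using B(3)[of y] by simp
        then show ?thesis by simp
      qed
    qed
  qed measurable
qed

text \<open>The quadratic factor removes the singularity at the origin: it beats the growth $1/|w|$
  allowed by \<^const>\<open>weak_kernel\<close>.\<close>
definition cutoff_kernel :: "(complex \<Rightarrow> complex) \<Rightarrow> real \<Rightarrow> complex \<Rightarrow> complex" where
  "cutoff_kernel k e w = of_real (min 1 ((norm w / e)\<^sup>2)) * k w"

lemma norm_cutoff_kernel_le: "norm (cutoff_kernel k e w) \<le> norm (k w)"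
proof -
  have "min 1 ((norm w / e)\<^sup>2) * norm (k w) \<le> 1 * norm (k w)"
    by (intro mult_right_mono) auto
  then show ?thesis by (simp add: cutoff_kernel_def norm_mult abs_of_nonneg)
qed

lemma continuous_cutoff_kernel:
  assumes k: "weak_kernel k" and e: "e > 0"
  shows "continuous_on UNIV (cutoff_kernel k e)"
proof -
  obtain C where C: "C \<ge> 0" "\<And>w. norm (k w) \<le> C * (inverse (norm w) + norm w)"
    using weak_kernelE[OF k] by blast
  have "isCont (cutoff_kernel k e) w" for w
  proof (cases "w = 0")
    case False
    have "isCont k w" using k False unfolding weak_kernel_def
      by (metis ComplI continuous_on_eq_continuous_at open_delete open_UNIV Compl_eq_Diff_UNIV singletonD)
    then show ?thesis unfolding cutoff_kernel_def[abs_def] using e by (intro continuous_intros) auto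
  next
    case True
    have bd: "norm (cutoff_kernel k e v) \<le> C / e\<^sup>2 * (norm v + norm v ^ 3)" for v
    proof -
      have "norm (cutoff_kernel k e v) \<le> (norm v / e)\<^sup>2 * (C * (inverse (norm v) + norm v))"
        unfolding cutoff_kernel_def norm_mult by (intro mult_mono C(2)) (auto simp: abs_of_nonneg)
      also have "\<dots> = C / e\<^sup>2 * (norm v + norm v ^ 3)"
      proof (cases "v = 0")
        case False
        then have "norm v * norm v * inverse (norm v) = norm v" by simp
        moreover have "(norm v / e)\<^sup>2 * (C * (inverse (norm v) + norm v))
            = C / e\<^sup>2 * (norm v * norm v * inverse (norm v) + norm v ^ 3)"
          by (simp add: algebra_simps power2_eq_square power3_eq_cube)
        ultimately show ?thesis by simp
      qed simp
      finally show ?thesis .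
    qed
    have "((\<lambda>v::complex. C / e\<^sup>2 * (norm v + norm v ^ 3)) \<longlongrightarrow> C / e\<^sup>2 * (norm (0::complex) + norm (0::complex) ^ 3)) (at 0)"
      by (intro tendsto_add tendsto_mult tendsto_const tendsto_power tendsto_norm[OF tendsto_ident_at])
    then have "((\<lambda>v. C / e\<^sup>2 * (norm v + norm v ^ 3)) \<longlongrightarrow> 0) (at (0::complex))" by simp
    then have "((cutoff_kernel k e) \<longlongrightarrow> 0) (at 0)"
      by (rule Lim_null_comparison[rotated]) (use bd in auto)
    then show ?thesis using True by (simp add: isCont_def cutoff_kernel_def)
  qed
  then show ?thesis by (simp add: continuous_at_imp_continuous_on)
qed

lemma weak_kernel_cutoff:
  assumes "weak_kernel k" "e > 0"
  shows "weak_kernel (cutoff_kernel k e)"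
proof -
  obtain C where C: "\<And>w. norm (k w) \<le> C * (inverse (norm w) + norm w)"
    using weak_kernelE[OF assms(1)] by blast
  show ?thesis unfolding weak_kernel_def
  proof (intro conjI exI allI)
    show "continuous_on (-{0}) (cutoff_kernel k e)"
      using continuous_on_subset[OF continuous_cutoff_kernel[OF assms]] by blast
    show "norm (cutoff_kernel k e w) \<le> C * (inverse (norm w) + norm w)" for w
      using norm_cutoff_kernel_le C order_trans by blast
  qed
qed

text \<open>With the raw kernel the singularity moves with the evaluation point, which prevents a
  common dominating function. The cut-off kernel is bounded on compact sets, so a constant on the
  disc of radius \<open>M\<close> dominates along any convergent sequence.\<close>

lemma continuous_potential_cutoff:
  assumes k: "weak_kernel k" and g: "bdd_density g" and e: "e > 0"
  shows "continuous_on UNIV (potential (cutoff_kernel k e) g)"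
proof -
  obtain B M where B: "B > 0" "M > 0" "\<And>y. norm (g y) \<le> B * indicator (ball 0 M) y"
    using bdd_densityE[OF g] by blast
  let ?k = "cutoff_kernel k e"
  have cont: "continuous_on UNIV ?k" by (rule continuous_cutoff_kernel[OF k e])
  have [measurable]: "?k \<in> borel_measurable borel" "g \<in> borel_measurable borel"
    using weak_kernel_measurable[OF weak_kernel_cutoff[OF k e]] g by (auto simp: bdd_density_def)
  have "continuous (at a) (potential ?k g)" for a
    unfolding continuous_at_sequentially o_def
  proof (intro allI impI)
    fix x :: "nat \<Rightarrow> complex" assume x: "x \<longlonglongrightarrow> a"
    obtain L where L: "L > 0" "\<And>n. norm (x n) \<le> L"
      using convergent_imp_Bseq[of x] x unfolding convergent_def Bseq_def by blast
    have "compact (?k ` cball 0 (L + M))"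
      by (intro compact_continuous_image continuous_on_subset[OF cont]) auto
    then obtain K where K: "K > 0" "\<And>w. norm w \<le> L + M \<Longrightarrow> norm (?k w) \<le> K"
      by (force dest!: compact_imp_bounded simp: bounded_pos)
    show "(\<lambda>n. potential ?k g (x n)) \<longlonglongrightarrow> potential ?k g a"
      unfolding potential_def
    proof (rule integral_dominated_convergence)
      show "integrable lborel (\<lambda>y. K * B * indicator (ball (0::complex) M) y)"
        by (intro integrable_mult_right integrable_real_indicator) (auto simp: emeasure_lborel_ball_finite[unfolded infinity_ennreal_def])
      show "AE y in lborel. (\<lambda>n. ?k (x n - y) * g y) \<longlonglongrightarrow> ?k (a - y) * g y"
      proof (intro AE_I2 tendsto_intros)
        fix y
        have "isCont ?k (a - y)" using cont by (simp add: continuous_on_eq_continuous_at)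
        then show "(\<lambda>n. ?k (x n - y)) \<longlonglongrightarrow> ?k (a - y)"
          by (rule isCont_tendsto_compose) (intro tendsto_intros x)
      qed
      show "AE y in lborel. norm (?k (x n - y) * g y) \<le> K * B * indicator (ball 0 M) y" for n
      proof (intro AE_I2)
        fix y
        show "norm (?k (x n - y) * g y) \<le> K * B * indicator (ball 0 M) y"
        proof (cases "y \<in> ball 0 M")
          case True
          then have "norm (x n - y) \<le> L + M" using L(2)[of n] norm_triangle_ineq4[of "x n" y] by auto
          then show ?thesis unfolding norm_mult using B(3)[of y] K True
            by (auto intro!: mult_mono)
        next
          case False
          then show ?thesis using B(3)[of y] by simp
        qed
      qed
    qed measurable
  qed
  then show ?thesis by (simp add: continuous_at_imp_continuous_on)
qed

text \<open>The two kernels differ only within distance \<open>e\<close> of \<open>z\<close>, where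
  the integral of 1/|z - y| is O(e). The constant does not depend on \<open>z\<close>, and this
  uniformity lets continuity pass to the limit.\<close>

lemma potential_cutoff_error:
  assumes k: "weak_kernel k" and g: "bdd_density g"
  obtains A where "A \<ge> 0" "\<And>e z. 0 < e \<Longrightarrow> e \<le> 1 \<Longrightarrow> norm (potential (cutoff_kernel k e) g z - potential k g z) \<le> A * e"
proof -
  obtain B M where B: "B > 0" "M > 0" "\<And>y. norm (g y) \<le> B * indicator (ball 0 M) y"
    using bdd_densityE[OF g] by blast
  have gB: "norm (g y) \<le> B" for y using B(3)[of y] B(1) by (cases "y \<in> ball 0 M") auto
  obtain C where C: "C \<ge> 0" "\<And>w. norm (k w) \<le> C * (inverse (norm w) + norm w)"
    using weak_kernelE[OF k] by blast
  have "norm (potential (cutoff_kernel k e) g z - potential k g z) \<le> (2 * C * B * (4 * pi)) * e"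
    if e: "0 < e" "e \<le> 1" for e z
  proof -
    let ?k = "cutoff_kernel k e"
    note i1 = integrable_potential[OF weak_kernel_cutoff[OF k e(1)] g, of z]
    note i2 = integrable_potential[OF k g, of z]
    let ?b = "\<lambda>y. 2 * C * B * (indicator (ball z e) y * inverse (norm (z - y)))"
    have "potential ?k g z - potential k g z = (LINT y|lborel. ?k (z - y) * g y - k (z - y) * g y)"
      unfolding potential_def using i1 i2 by simp
    also have "norm \<dots> \<le> (LINT y|lborel. ?b y)"
    proof (rule Bochner_Integration.integral_norm_bound_integral)
      show "integrable lborel ?b"
        by (intro integrable_mult_right integrable_inverse_dist_ball e)
      fix y
      show "norm (?k (z - y) * g y - k (z - y) * g y) \<le> ?b y"
      proof (cases "norm (z - y) < e")
        case True
        let ?w = "z - y"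
        have "(norm ?w / e)\<^sup>2 \<le> 1" using True e by (simp add: power_le_one)
        then have m: "min 1 ((norm ?w / e)\<^sup>2) = (norm ?w / e)\<^sup>2" by simp
        have "norm (?k ?w - k ?w) = norm (of_real ((norm ?w / e)\<^sup>2 - 1) * k ?w)"
          by (simp add: cutoff_kernel_def m algebra_simps)
        also have "\<dots> \<le> 1 * norm (k ?w)"
          unfolding norm_mult norm_of_real using \<open>(norm ?w / e)\<^sup>2 \<le> 1\<close>
          by (intro mult_right_mono) auto
        also have "\<dots> \<le> C * (inverse (norm ?w) + norm ?w)" using C by simp
        \<comment> \<open>Here \<open>e \<le> 1\<close> enters: the linear term of the kernel bound
          is absorbed into the singular one, which accounts for the factor 2. At
          \<open>?w = 0\<close> both sides vanish since \<open>inverse 0 = 0\<close>.\<close>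
        also have "norm ?w \<le> inverse (norm ?w)"
        proof (cases "?w = 0")
          case False
          have "norm ?w \<le> 1" using True e by simp
          then have "1 \<le> inverse (norm ?w)" using False by (intro one_le_inverse) auto
          then show ?thesis using \<open>norm ?w \<le> 1\<close> by linarith
        qed simp
        then have "C * (inverse (norm ?w) + norm ?w) \<le> C * (inverse (norm ?w) + inverse (norm ?w))"
          using C by (intro mult_left_mono) auto
        finally have "norm (?k ?w - k ?w) * norm (g y) \<le> C * (inverse (norm ?w) + inverse (norm ?w)) * B"
          using gB C by (intro mult_mono) auto
        then show ?thesis using True by (simp add: norm_mult[symmetric] algebra_simps dist_norm)
      next
        case False
        then have "(norm (z - y) / e)\<^sup>2 \<ge> 1" using e by simp
        then have "?k (z - y) = k (z - y)" by (simp add: cutoff_kernel_def)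
        then show ?thesis using False by (simp add: dist_norm)
      qed
    qed (use i1 i2 in auto)
    also have "\<dots> \<le> 2 * C * B * (4 * pi * e)"
      using mult_left_mono[OF integrable_inverse_dist_ball(2)[OF e(1), of z], of "2 * C * B"] C B by simp
    finally show ?thesis by (simp add: algebra_simps)
  qed
  moreover have "2 * C * B * (4 * pi) \<ge> 0" using C B by simp
  ultimately show ?thesis using that by blast
qed

lemma continuous_potential:
  assumes k: "weak_kernel k" and g: "bdd_density g"
  shows "continuous_on UNIV (potential k g)"
proof -
  obtain A where A: "A \<ge> 0" "\<And>e z. 0 < e \<Longrightarrow> e \<le> 1 \<Longrightarrow> norm (potential (cutoff_kernel k e) g z - potential k g z) \<le> A * e"
    using potential_cutoff_error[OF assms] by blast
  show ?thesis
  proof (rule uniform_limit_theorem)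
    show "\<forall>\<^sub>F n in sequentially. continuous_on UNIV (potential (cutoff_kernel k (inverse (real (Suc n)))) g)"
      using continuous_potential_cutoff[OF assms] by (intro always_eventually) auto
    show "uniform_limit UNIV (\<lambda>n. potential (cutoff_kernel k (inverse (real (Suc n)))) g) (potential k g) sequentially"
    proof (rule uniform_limitI)
      fix d :: real assume d: "d > 0"
      have "(\<lambda>n. A * inverse (real (Suc n))) \<longlonglongrightarrow> A * 0"
        by (intro tendsto_intros LIMSEQ_inverse_real_of_nat)
      then have "\<forall>\<^sub>F n in sequentially. A * inverse (real (Suc n)) < d"
        using d by (auto dest: order_tendstoD(2))
      then show "\<forall>\<^sub>F n in sequentially. \<forall>x\<in>UNIV. dist (potential (cutoff_kernel k (inverse (real (Suc n)))) g x) (potential k g x) < d"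
      proof eventually_elim
        case (elim n)
        have "inverse (real (Suc n)) > 0" "inverse (real (Suc n)) \<le> 1" by (auto intro: inverse_le_1_iff[THEN iffD2])
        from A(2)[OF this] elim show ?case by (force simp: dist_norm intro: le_less_trans)
      qed
    qed
  qed simp
qed

lemma weak_kernel_inverse: "weak_kernel inverse"
  unfolding weak_kernel_def
  by (auto intro!: continuous_intros exI[of _ 1] simp: norm_inverse)

text \<open>Both signs follow from ln t <= t - 1, applied to |w| and to 1/|w|. At the origin the
  default value \<open>ln 0 = 0\<close> makes the bound hold.\<close>

lemma weak_kernel_ln: "weak_kernel (\<lambda>w. of_real (ln (norm w)))"
  unfolding weak_kernel_def
proof (intro conjI exI allI)
  show "continuous_on (- {0}) (\<lambda>w. of_real (ln (norm (w::complex))) :: complex)"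
    by (intro continuous_intros) auto
  show "norm (of_real (ln (norm w)) :: complex) \<le> 1 * (inverse (norm w) + norm w)" for w :: complex
  proof (cases "w = 0")
    case False
    have "ln (norm w) \<le> norm w" using ln_le_minus_one[of "norm w"] False by simp
    moreover have "- ln (norm w) \<le> inverse (norm w)"
      using ln_le_minus_one[of "inverse (norm w)"] False by (simp add: ln_inverse)
    moreover have "inverse (norm w) \<ge> 0" "norm w \<ge> 0" by auto
    ultimately show ?thesis by (simp only: norm_of_real mult_1 abs_le_iff) linarith
  qed simp
qed

section \<open>The Cauchy transform\<close>

lemma bdd_density_indicator:
  assumes "A \<in> sets borel" "bounded A"
  shows "bdd_density (indicator A)"
  unfolding bdd_density_def
proof (intro conjI)
  show "indicator A \<in> borel_measurable borel" using assms by simp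
  show "bounded (range (indicator A :: complex \<Rightarrow> complex))"
    by (rule boundedI[of _ 1]) (auto simp: indicator_def)
  show "bounded {y. indicator A y \<noteq> (0::complex)}"
    using assms(2) by (rule bounded_subset) (auto simp: indicator_def)
qed

lemma integral_indicator_complex:
  assumes "A \<in> sets borel" "bounded A"
  shows "(LINT y|lborel. indicator A y) = complex_of_real (measure lborel A)"
proof -
  have "(LINT y|lborel. indicator A y) = (LINT y|lborel. complex_of_real (indicator A y))"
    by (simp add: of_real_indicator)
  also have "\<dots> = complex_of_real (measure lborel A)"
    using assms by (simp only: integral_complex_of_real) simp
  finally show ?thesis .
qed

text \<open>The bound on \<open>f\<close> is asked for only where \<open>g\<close> is nonzero, since
  multipliers such as \<open>inverse (z0 - y)\<close> are unbounded elsewhere.\<close>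

lemma bdd_density_mult:
  assumes g: "bdd_density g" and f: "f \<in> borel_measurable borel" and b: "\<And>y. g y \<noteq> 0 \<Longrightarrow> norm (f y) \<le> L"
  shows "bdd_density (\<lambda>y. f y * g y)"
  unfolding bdd_density_def
proof (intro conjI)
  have [measurable]: "g \<in> borel_measurable borel" "f \<in> borel_measurable borel"
    using g f by (auto simp: bdd_density_def)
  show "(\<lambda>y. f y * g y) \<in> borel_measurable borel" by measurable
  obtain B where B: "B > 0" "\<And>y. norm (g y) \<le> B"
    using g unfolding bdd_density_def bounded_pos by auto
  have "norm (f y * g y) \<le> \<bar>L\<bar> * B" for y
  proof (cases "g y = 0")
    case False
    then show ?thesis unfolding norm_mult using b[OF False] B by (intro mult_mono) auto
  qed (use B in auto)
  then show "bounded (range (\<lambda>y. f y * g y))" by (intro boundedI[of _ "\<bar>L\<bar> * B"]) auto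
  have "bounded {y. g y \<noteq> 0}" using g by (auto simp: bdd_density_def)
  then show "bounded {y. f y * g y \<noteq> 0}" by (rule bounded_subset) auto
qed

abbreviation cauchy_transform :: "(complex \<Rightarrow> complex) \<Rightarrow> complex \<Rightarrow> complex" where
  "cauchy_transform \<equiv> potential inverse"

lemmas integrable_cauchy = integrable_potential[OF weak_kernel_inverse]
lemmas continuous_cauchy = continuous_potential[OF weak_kernel_inverse]

text \<open>No differentiation under the integral: by partial fractions the difference quotient at
  \<open>z0\<close> is minus the Cauchy transform of g(y)/(z0 - y). That density is bounded because
  \<open>g\<close> vanishes near \<open>z0\<close>, so continuity of potentials yields the
  derivative through Caratheodory's criterion.\<close>

lemma cauchy_transform_holomorphic:
  assumes g: "bdd_density g" and S: "open S" and z: "\<And>y. y \<in> S \<Longrightarrow> g y = 0"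
  shows "cauchy_transform g holomorphic_on S"
  unfolding holomorphic_on_open[OF S]
proof (intro ballI)
  fix z0 assume z0: "z0 \<in> S"
  obtain d where d: "d > 0" "ball z0 d \<subseteq> S" using S z0 openE by blast
  define g1 where "g1 = (\<lambda>y. inverse (z0 - y) * g y)"
  have g1: "bdd_density g1" unfolding g1_def
  proof (rule bdd_density_mult[OF g, of _ "inverse d"])
    fix y assume "g y \<noteq> 0"
    then have "y \<notin> ball z0 d" using d z by auto
    then show "norm (inverse (z0 - y)) \<le> inverse d"
      using d by (auto simp: norm_inverse dist_norm intro!: le_imp_inverse_le)
  qed measurable
  have "cauchy_transform g w - cauchy_transform g z0 = - cauchy_transform g1 w * (w - z0)" for w
  proof -
    have "cauchy_transform g w - cauchy_transform g z0 = (LINT y|lborel. inverse (w - y) * g y - inverse (z0 - y) * g y)"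
      unfolding potential_def using integrable_cauchy[OF g] by simp
    also have "\<dots> = (LINT y|lborel. - (w - z0) * (inverse (w - y) * g1 y))"
    proof (rule integral_cong_AE)
      \<comment> \<open>The identity may fail at the poles \<open>w\<close> and \<open>z0\<close>,
        where \<open>inverse 0 = 0\<close> intervenes; single points are null.\<close>
      show "AE y in lborel. inverse (w - y) * g y - inverse (z0 - y) * g y = - (w - z0) * (inverse (w - y) * g1 y)"
        using AE_lborel_singleton[of w] AE_lborel_singleton[of z0]
      proof eventually_elim
        case (elim y)
        then have "w - y \<noteq> 0" "z0 - y \<noteq> 0" by auto
        then show ?case by (simp add: g1_def field_simps)
      qed
    qed (use integrable_cauchy[OF g] integrable_cauchy[OF g1] in auto)
    also have "\<dots> = - (w - z0) * cauchy_transform g1 w"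
      unfolding potential_def by (rule integral_mult_right_zero)
    finally show ?thesis by (simp add: algebra_simps)
  qed
  moreover have "isCont (\<lambda>w. - cauchy_transform g1 w) z0"
    using continuous_cauchy[OF g1] by (intro continuous_intros) (simp add: continuous_on_eq_continuous_at)
  ultimately have "(cauchy_transform g has_field_derivative - cauchy_transform g1 z0) (at z0)"
    unfolding CARAT_DERIV
    by (intro exI[of _ "\<lambda>w. - cauchy_transform g1 w"]) auto
  then show "\<exists>f'. (cauchy_transform g has_field_derivative f') (at z0)" ..
qed

lemma cauchy_transform_decay:
  assumes g: "bdd_density g"
  shows "(cauchy_transform g \<longlongrightarrow> 0) at_infinity"
proof -
  obtain B M where B: "B > 0" "M > 0" "\<And>y. norm (g y) \<le> B * indicator (ball 0 M) y"
    using bdd_densityE[OF g] by blast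
  have bd: "norm (cauchy_transform g z) \<le> (B * (pi * M\<^sup>2)) * inverse (norm z - M)" if "norm z > M" for z
  proof -
    have "norm (cauchy_transform g z) \<le> (LINT y|lborel. (B * inverse (norm z - M)) * indicator (ball (0::complex) M) y)"
      unfolding potential_def
    proof (rule Bochner_Integration.integral_norm_bound_integral)
      show "integrable lborel (\<lambda>y. (B * inverse (norm z - M)) * indicator (ball (0::complex) M) y)"
        by (intro integrable_mult_right integrable_real_indicator) (auto simp: emeasure_lborel_ball_finite[unfolded infinity_ennreal_def])
      fix y
      show "norm (inverse (z - y) * g y) \<le> B * inverse (norm z - M) * indicator (ball 0 M) y"
      proof (cases "y \<in> ball 0 M")
        case True
        have "norm z - M \<le> norm (z - y)" using True norm_triangle_ineq2[of z y] by simp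
        then have "inverse (norm (z - y)) \<le> inverse (norm z - M)" using that by (intro le_imp_inverse_le) auto
        then have "inverse (norm (z - y)) * norm (g y) \<le> inverse (norm z - M) * B"
          using B(1) B(3)[of y] True that by (intro mult_mono) auto
        then show ?thesis using True by (simp add: norm_mult norm_inverse mult.commute)
      next
        case False
        then show ?thesis using B(3)[of y] by simp
      qed
    qed (rule integrable_cauchy[OF g])
    also have "\<dots> = B * inverse (norm z - M) * (pi * M\<^sup>2)"
      using B by (simp add: content_ball unit_ball_vol_2)
    finally show ?thesis by (simp add: algebra_simps)
  qed
  have "filterlim (\<lambda>z::complex. - M + norm z) at_top at_infinity"
    by (intro filterlim_tendsto_add_at_top[OF tendsto_const] filterlim_norm_at_top)
  then have "((\<lambda>z::complex. inverse (- M + norm z)) \<longlongrightarrow> 0) at_infinity"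
    by (rule tendsto_inverse_0_at_top)
  then have "((\<lambda>z::complex. inverse (norm z - M)) \<longlongrightarrow> 0) at_infinity" by simp
  then have "((\<lambda>z::complex. (B * (pi * M\<^sup>2)) * inverse (norm z - M)) \<longlongrightarrow> 0) at_infinity"
    by (rule tendsto_mult_right_zero)
  moreover have "\<forall>\<^sub>F z in at_infinity. norm (cauchy_transform g z) \<le> (B * (pi * M\<^sup>2)) * inverse (norm z - M)"
    unfolding eventually_at_infinity by (intro exI[of _ "M + 1"]) (auto intro!: bd)
  ultimately show ?thesis by (rule Lim_null_comparison[rotated])
qed

lemma bdd_density_integrable:
  assumes g: "bdd_density g"
  shows "integrable lborel g"
proof -
  obtain B M where B: "B > 0" "M > 0" "\<And>y. norm (g y) \<le> B * indicator (ball 0 M) y"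
    using bdd_densityE[OF g] by blast
  show ?thesis
  proof (rule Bochner_Integration.integrable_bound)
    show "integrable lborel (\<lambda>y. B * indicator (ball (0::complex) M) y)"
      by (intro integrable_mult_right integrable_real_indicator) (auto simp: emeasure_lborel_ball_finite[unfolded infinity_ennreal_def])
    show "AE y in lborel. norm (g y) \<le> norm (B * indicator (ball (0::complex) M) y)"
      using B by (intro AE_I2) (auto simp: abs_mult)
  qed (use g in \<open>auto simp: bdd_density_def\<close>)
qed

text \<open>Since z/(z - y) = 1 + y/(z - y), the deviation from the total mass is the Cauchy
  transform of y * g(y), which decays.\<close>

lemma cauchy_transform_at_infinity:
  assumes g: "bdd_density g"
  shows "((\<lambda>z. z * cauchy_transform g z) \<longlongrightarrow> (LINT y|lborel. g y)) at_infinity"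
proof -
  have yg: "bdd_density (\<lambda>y. y * g y)"
  proof -
    obtain M where M: "\<And>y. g y \<noteq> 0 \<Longrightarrow> norm y \<le> M"
      using g unfolding bdd_density_def bounded_pos by auto
    show ?thesis using M by (intro bdd_density_mult[OF g, of _ M]) auto
  qed
  have "z * cauchy_transform g z = (LINT y|lborel. g y) + cauchy_transform (\<lambda>y. y * g y) z" for z
  proof -
    have "z * cauchy_transform g z = (LINT y|lborel. z * (inverse (z - y) * g y))"
      unfolding potential_def by simp
    also have "\<dots> = (LINT y|lborel. g y + inverse (z - y) * (y * g y))"
    proof (rule integral_cong_AE)
      show "AE y in lborel. z * (inverse (z - y) * g y) = g y + inverse (z - y) * (y * g y)"
        using AE_lborel_singleton[of z]
      proof eventually_elim
        case (elim y)
        then have "z - y \<noteq> 0" by auto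
        then show ?case by (simp add: field_simps)
      qed
    qed (use integrable_cauchy[OF g] integrable_cauchy[OF yg] bdd_density_integrable[OF g] in auto)
    also have "\<dots> = (LINT y|lborel. g y) + cauchy_transform (\<lambda>y. y * g y) z"
      unfolding potential_def using integrable_cauchy[OF yg] bdd_density_integrable[OF g] by simp
    finally show ?thesis .
  qed
  moreover have "((\<lambda>z. (LINT y|lborel. g y) + cauchy_transform (\<lambda>y. y * g y) z) \<longlongrightarrow> (LINT y|lborel. g y) + 0) at_infinity"
    by (intro tendsto_intros cauchy_transform_decay yg)
  ultimately show ?thesis by simp
qed

section \<open>Symmetries of the Cauchy transform and its values on discs\<close>

lemma cauchy_transform_add:
  assumes "bdd_density f" "bdd_density g"
  shows "cauchy_transform (\<lambda>y. f y + g y) z = cauchy_transform f z + cauchy_transform g z"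
  unfolding potential_def using integrable_cauchy[OF assms(1)] integrable_cauchy[OF assms(2)]
  by (simp add: distrib_left)

lemma cauchy_transform_translate:
  assumes "bdd_density g"
  shows "cauchy_transform (\<lambda>y. g (y - c)) z = cauchy_transform g (z - c)"
proof -
  have "cauchy_transform g (z - c) = (LINT y|distr lborel borel ((+) (-c)). inverse (z - c - y) * g y)"
    unfolding potential_def by (subst lborel_distr_plus) simp
  also have "\<dots> = (LINT y|lborel. inverse (z - c - (- c + y)) * g (- c + y))"
    using integrable_cauchy[OF assms, of "z - c"] by (subst integral_distr) auto
  finally show ?thesis by (simp add: potential_def)
qed

lemma cauchy_transform_rotate:
  assumes g: "bdd_density g" and w: "norm w = 1" and inv: "\<And>y. g (w * y) = g y"
  shows "cauchy_transform g (w * z) = inverse w * cauchy_transform g z"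
proof -
  have "cauchy_transform g (w * z) = (LINT y|distr lborel borel ((*) w). inverse (w * z - y) * g y)"
    unfolding potential_def by (subst lborel_distr_rotation[OF w]) simp
  also have "\<dots> = (LINT y|lborel. inverse (w * z - w * y) * g (w * y))"
    using integrable_cauchy[OF g, of "w * z"] by (subst integral_distr) auto
  also have "\<dots> = (LINT y|lborel. inverse w * (inverse (z - y) * g y))"
    by (simp add: right_diff_distrib[symmetric] inv mult.assoc)
  also have "\<dots> = inverse w * cauchy_transform g z"
    unfolding potential_def by (rule integral_mult_right_zero)
  finally show ?thesis .
qed

text \<open>Differentiating the constant function t -> G(exp(i t) z) at t = 0 gives i * z * G'(z) =
  0, so G' vanishes away from 0. The origin is an exceptional point covered by continuity.\<close>

lemma rotation_invariant_holomorphic_constant: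
  assumes G: "G holomorphic_on S" and S: "open S" "connected S"
    and rot: "\<And>w z. norm w = 1 \<Longrightarrow> G (w * z) = G z"
  shows "G constant_on S"
proof (rule DERIV_zero_connected_constant_on)
  show "\<forall>z\<in>S - {0}. (G has_field_derivative 0) (at z)"
  proof
    fix z assume z: "z \<in> S - {0}"
    obtain D where D: "(G has_field_derivative D) (at z)"
      using G S z holomorphic_on_open by blast
    have "((\<lambda>t. exp (\<i> * t) * z) has_field_derivative \<i> * z) (at (of_real 0))"
      by (auto intro!: derivative_eq_intros)
    then have "((\<lambda>t. G (exp (\<i> * t) * z)) has_field_derivative D * (\<i> * z)) (at (of_real 0))"
      using D by (intro DERIV_chain2[of G]) auto
    moreover have "(complex_of_real has_vector_derivative 1) (at 0)"
      using bounded_linear.has_vector_derivative[OF bounded_linear_of_real has_vector_derivative_id] by simp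
    ultimately have "((\<lambda>t. G (exp (\<i> * t) * z)) \<circ> of_real has_vector_derivative 1 * (D * (\<i> * z))) (at 0)"
      by (intro field_vector_diff_chain_at)
    moreover have "(\<lambda>t. G (exp (\<i> * t) * z)) \<circ> of_real = (\<lambda>t::real. G z)"
      by (auto simp: rot)
    ultimately have "1 * (D * (\<i> * z)) = 0"
      by (metis vector_derivative_unique_at has_vector_derivative_const)
    then show "(G has_field_derivative 0) (at z)" using D z by simp
  qed
qed (use S G holomorphic_on_imp_continuous_on in auto)

text \<open>Split the disc at radius \<open>norm z\<close>. For both pieces, \<open>u\<close> times the Cauchy transform at \<open>u\<close>
  is rotation invariant, hence constant wherever it is holomorphic: zero inside the annulus and
  the area outside the small disc.\<close>
lemma cauchy_transform_centered_disc:
  assumes z: "norm z < r"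
  shows "cauchy_transform (indicator (ball 0 r)) z = of_real pi * cnj z"
proof (cases "z = 0")
  case True
  \<comment> \<open>Rotation by a half turn fixes the origin and reverses the sign of the transform,
    whose value there must therefore be 0.\<close>
  have "cauchy_transform (indicator (ball 0 r)) ((-1) * 0) = inverse (-1) * cauchy_transform (indicator (ball 0 r)) 0"
    by (rule cauchy_transform_rotate) (auto intro!: bdd_density_indicator simp: indicator_def)
  then show ?thesis using True by simp
next
  case False
  \<comment> \<open>With this radius \<open>z\<close> lies on the boundary of both regions of
    holomorphy, and its values are reached by continuity of the transforms.\<close>
  define t where "t = norm z"
  have t: "t > 0" "t < r" using False z by (auto simp: t_def)
  let ?b = "indicator (ball 0 t) :: complex \<Rightarrow> complex"
  let ?a = "indicator (ball 0 r - ball 0 t) :: complex \<Rightarrow> complex"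
  have b: "bdd_density ?b" and a: "bdd_density ?a"
    by (auto intro!: bdd_density_indicator intro: bounded_subset[OF bounded_ball])
  have rot: "(w * u) * cauchy_transform ?b (w * u) = u * cauchy_transform ?b u"
            "(w * u) * cauchy_transform ?a (w * u) = u * cauchy_transform ?a u" if w: "norm w = 1" for w u
  proof -
    have "w \<noteq> 0" using w by auto
    then show "(w * u) * cauchy_transform ?b (w * u) = u * cauchy_transform ?b u"
      "(w * u) * cauchy_transform ?a (w * u) = u * cauchy_transform ?a u"
      using cauchy_transform_rotate[OF b w, of u] cauchy_transform_rotate[OF a w, of u] w
      by (simp_all add: indicator_def norm_mult)
  qed
  have "(\<lambda>u. u * cauchy_transform ?a u) constant_on ball 0 t"
    by (intro rotation_invariant_holomorphic_constant holomorphic_intros cauchy_transform_holomorphic a rot) auto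
  \<comment> \<open>The constant is read off at the centre, where the factor \<open>u\<close> is
    0.\<close>
  then have "u * cauchy_transform ?a u = 0" if "u \<in> ball 0 t" for u
    using that t unfolding constant_on_def by (metis centre_in_ball mult_zero_left)
  moreover have "continuous_on (closure (ball 0 t)) (\<lambda>u. u * cauchy_transform ?a u)"
    by (intro continuous_intros continuous_on_subset[OF continuous_cauchy[OF a]]) auto
  moreover have "z \<in> closure (ball 0 t)" using t by (simp add: t_def)
  ultimately have "z * cauchy_transform ?a z = 0"
    using continuous_constant_on_closure[of "ball 0 t" "\<lambda>u. u * cauchy_transform ?a u" 0 z] by blast
  then have az: "cauchy_transform ?a z = 0" using False by simp
  have conn: "connected (- cball (0::complex) t)"
    by (intro connected_complement_bounded_convex) auto
  have "(\<lambda>u. u * cauchy_transform ?b u) constant_on (- cball 0 t)"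
    by (intro rotation_invariant_holomorphic_constant holomorphic_intros cauchy_transform_holomorphic b rot conn) auto
  then obtain c where c: "\<And>u. u \<in> - cball 0 t \<Longrightarrow> u * cauchy_transform ?b u = c"
    unfolding constant_on_def by auto
  have "((\<lambda>u. u * cauchy_transform ?b u) \<longlongrightarrow> c) at_infinity"
    by (rule tendsto_eventually) (auto simp: eventually_at_infinity intro!: exI[of _ "t + 1"] c)
  then have "c = (LINT y|lborel. ?b y)"
    using cauchy_transform_at_infinity[OF b] tendsto_unique[OF trivial_limit_at_infinity] by blast
  also have "\<dots> = of_real (pi * t\<^sup>2)"
    using t by (simp add: integral_indicator_complex content_ball unit_ball_vol_2)
  finally have ceq: "c = of_real (pi * t\<^sup>2)" .
  have "continuous_on (closure (- cball 0 t)) (\<lambda>u. u * cauchy_transform ?b u)"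
    by (intro continuous_intros continuous_on_subset[OF continuous_cauchy[OF b]]) auto
  moreover have "z \<in> closure (- cball 0 t)" by (simp add: closure_complement t_def)
  ultimately have "z * cauchy_transform ?b z = c"
    using c continuous_constant_on_closure[of "- cball 0 t" "\<lambda>u. u * cauchy_transform ?b u" c z] by blast
  also have "c = z * (of_real pi * cnj z)"
    unfolding ceq t_def by (simp add: complex_norm_square[symmetric] algebra_simps)
  finally have bz: "cauchy_transform ?b z = of_real pi * cnj z" using False by simp
  have "indicator (ball 0 r) = (\<lambda>y. ?b y + ?a y)"
    using t by (auto simp: indicator_def fun_eq_iff)
  then have "cauchy_transform (indicator (ball 0 r)) z = cauchy_transform ?b z + cauchy_transform ?a z"
    using cauchy_transform_add[OF b a] by simp
  then show ?thesis using az bz by simp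
qed

lemma cauchy_transform_disc:
  assumes z: "z \<in> ball c r"
  shows "cauchy_transform (indicator (ball c r)) z = of_real pi * cnj (z - c)"
proof -
  have "indicator (ball c r) = (\<lambda>y. indicator (ball 0 r) (y - c) :: complex)"
    by (auto simp: indicator_def fun_eq_iff dist_norm norm_minus_commute)
  moreover have "norm (z - c) < r" using z by (simp add: dist_norm norm_minus_commute)
  ultimately show ?thesis
    using cauchy_transform_translate[OF bdd_density_indicator, of "ball 0 r" c z]
      cauchy_transform_centered_disc[of "z - c" r] by simp
qed

text \<open>Near \<open>c\<close>, split off a disc contained in \<open>D\<close>. Its transform is
  pi * cnj (z - c), which cancels the nonholomorphic term up to a constant, and the rest of
  \<open>D\<close> contributes a function holomorphic on that disc.\<close>

lemma cauchy_transform_open_set_holomorphic: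
  assumes D: "open D" "bounded D"
  shows "(\<lambda>z. cauchy_transform (indicator D) z - of_real pi * cnj z) holomorphic_on D"
proof -
  have "(\<lambda>z. cauchy_transform (indicator D) z - of_real pi * cnj z) field_differentiable (at c)" if c: "c \<in> D" for c
  proof -
    obtain r where r: "r > 0" "ball c r \<subseteq> D" using D c openE by blast
    let ?b = "indicator (ball c r) :: complex \<Rightarrow> complex"
    let ?a = "indicator (D - ball c r) :: complex \<Rightarrow> complex"
    have b: "bdd_density ?b" and a: "bdd_density ?a"
      using D by (auto intro!: bdd_density_indicator intro: bounded_subset)
    have "indicator D = (\<lambda>y. ?b y + ?a y)"
      using r by (auto simp: indicator_def fun_eq_iff)
    then have eq: "cauchy_transform (indicator D) z = cauchy_transform ?b z + cauchy_transform ?a z" for z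
      using cauchy_transform_add[OF b a] by simp
    have "(\<lambda>z. cauchy_transform ?a z - of_real pi * cnj c) holomorphic_on ball c r"
      by (intro holomorphic_intros cauchy_transform_holomorphic a) auto
    moreover have "cauchy_transform ?a z - of_real pi * cnj c = cauchy_transform (indicator D) z - of_real pi * cnj z"
      if "z \<in> ball c r" for z
      using cauchy_transform_disc[OF that] by (simp add: eq algebra_simps)
    ultimately have "(\<lambda>z. cauchy_transform (indicator D) z - of_real pi * cnj z) holomorphic_on ball c r"
      by (rule holomorphic_transform)
    then show ?thesis using r by (auto intro: holomorphic_on_imp_differentiable_at)
  qed
  then show ?thesis by (simp add: holomorphic_on_def field_differentiable_at_within)
qed

section \<open>The gradient of the logarithmic potential\<close>

abbreviation log_kernel :: "complex \<Rightarrow> complex" where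
  "log_kernel \<equiv> (\<lambda>w. of_real (ln (norm w)))"

lemma AE_lborel_not_in_segment: "AE y in lborel. y \<notin> closed_segment (a::complex) b"
proof -
  have "interior (closed_segment a b) = {}"
    by (simp add: interior_closed_segment_ge2)
  then have "negligible (closed_segment a b)"
    by (simp add: negligible_convex_interior)
  then have "closed_segment a b \<in> null_sets lborel"
    by (simp add: negligible_iff_null_sets null_sets_completion_iff borel_closed)
  then show ?thesis by (rule AE_not_in)
qed

lemma ln_norm_along_segment:
  fixes a v :: complex
  assumes "\<And>t::real. 0 \<le> t \<Longrightarrow> t \<le> 1 \<Longrightarrow> a + of_real t * v \<noteq> 0"
  shows "(LINT t|lborel. indicator {0..1} t *\<^sub>R Re (v * inverse (a + of_real t * v))) = ln (norm (a + v)) - ln (norm a)"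
proof -
  have "(LINT t|lborel. indicator {0..1} t *\<^sub>R Re (v * inverse (a + of_real t * v)))
      = ln (norm (a + of_real 1 * v)) - ln (norm (a + of_real 0 * v))"
  proof (rule integral_FTC_Icc)
    fix t :: real assume t: "0 \<le> t" "t \<le> 1"
    have nz: "(Re a + t * Re v)\<^sup>2 + (Im a + t * Im v)\<^sup>2 \<noteq> 0"
      using assms[OF t] by (simp add: complex_eq_iff sum_power2_eq_zero_iff)
    then have pos: "(Re a + t * Re v)\<^sup>2 + (Im a + t * Im v)\<^sup>2 > 0"
      by (simp add: less_le)
    \<comment> \<open>Removes the square root, leaving a polynomial under the logarithm. The
      equation holds for every \<open>s\<close>, even at a zero, because \<open>ln 0 = 0\<close>;
      hence it can be rewritten under the lambda.\<close>
    have eq: "ln (norm (a + of_real s * v)) = ln ((Re a + s * Re v)\<^sup>2 + (Im a + s * Im v)\<^sup>2) / 2" for s :: real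
      by (cases "a + of_real s * v = 0") (auto simp: cmod_def ln_sqrt complex_eq_iff sum_power2_eq_zero_iff)
    have "((\<lambda>s. ln ((Re a + s * Re v)\<^sup>2 + (Im a + s * Im v)\<^sup>2)) has_real_derivative
        (2 * (Re a + t * Re v) * Re v + 2 * (Im a + t * Im v) * Im v) / ((Re a + t * Re v)\<^sup>2 + (Im a + t * Im v)\<^sup>2))
        (at t within {0..1})"
      using pos by (auto intro!: derivative_eq_intros simp: divide_inverse algebra_simps)
    from DERIV_cdivide[OF this, of 2]
    have "((\<lambda>s. ln ((Re a + s * Re v)\<^sup>2 + (Im a + s * Im v)\<^sup>2) / 2) has_real_derivative
        (2 * (Re a + t * Re v) * Re v + 2 * (Im a + t * Im v) * Im v) / ((Re a + t * Re v)\<^sup>2 + (Im a + t * Im v)\<^sup>2) / 2)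
        (at t within {0..1})" .
    moreover have "(2 * (Re a + t * Re v) * Re v + 2 * (Im a + t * Im v) * Im v) / ((Re a + t * Re v)\<^sup>2 + (Im a + t * Im v)\<^sup>2) / 2
        = Re (v * inverse (a + of_real t * v))"
    proof -
      have "(2 * x * b + 2 * y * d) / m / 2 = (b * x + d * y) / m" for x b y d m :: real
        by (cases "m = 0") (auto simp: field_simps)
      from this[of "Re a + t * Re v" "Re v" "Im a + t * Im v" "Im v" "(Re a + t * Re v)\<^sup>2 + (Im a + t * Im v)\<^sup>2"]
      show ?thesis
        unfolding divide_inverse[symmetric] Re_divide by simp
    qed
    ultimately have "((\<lambda>s. ln ((Re a + s * Re v)\<^sup>2 + (Im a + s * Im v)\<^sup>2) / 2) has_real_derivative
        Re (v * inverse (a + of_real t * v))) (at t within {0..1})"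
      by simp
    then show "((\<lambda>s. ln (norm (a + of_real s * v))) has_vector_derivative
        Re (v * inverse (a + of_real t * v))) (at t within {0..1})"
      unfolding eq has_real_derivative_iff_has_vector_derivative .
  next
    show "continuous_on {0..1} (\<lambda>t. Re (v * inverse (a + of_real t * v)))"
      using assms by (intro continuous_intros) auto
  qed simp
  then show ?thesis by simp
qed

text \<open>For fixed \<open>y\<close> off the segment from \<open>z\<close> to
  \<open>z + v\<close>, hence for almost every \<open>y\<close>, the increment of ln |x - y| is an
  integral along that segment. Fubini then exchanges the two integrals, in place of differentiation
  under a singular integral.\<close>

lemma log_potential_increment:
  assumes A: "A \<in> sets borel" "bounded A"
  shows "Re (potential log_kernel (indicator A) (z + v)) - Re (potential log_kernel (indicator A) z)
    = (LINT t|lborel. indicator {0..1} t *\<^sub>R Re (v * cauchy_transform (indicator A) (z + of_real t * v)))"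
proof -
  let ?g = "indicator A :: complex \<Rightarrow> complex"
  note g = bdd_density_indicator[OF A]
  have [measurable]: "A \<in> sets borel" by (rule A)
  define f where "f = (\<lambda>t y. indicator {0..1} t *\<^sub>R Re (v * (inverse (z + of_real t * v - y) * ?g y)))"
  \<comment> \<open>The potential of 1/|w| controls the absolute integral of \<open>f t\<close>.
    Being continuous, it is bounded by some \<open>K\<close> along the segment, and this is what
    Fubini needs.\<close>
  let ?N = "\<lambda>w::complex. of_real (inverse (norm w)) :: complex"
  have N: "weak_kernel ?N"
    unfolding weak_kernel_def by (auto intro!: continuous_intros exI[of _ 1] simp: norm_inverse)
  have "compact ((\<lambda>t::real. potential ?N ?g (z + of_real t * v)) ` {0..1})"
    by (intro compact_continuous_image continuous_on_compose2[OF continuous_potential[OF N g]] continuous_intros) auto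
  then obtain K where K: "\<And>t. 0 \<le> t \<Longrightarrow> t \<le> 1 \<Longrightarrow> norm (potential ?N ?g (z + of_real t * v)) \<le> K"
    by (force dest!: compact_imp_bounded simp: bounded_iff)
  have fi: "integrable lborel (f t)" for t
    unfolding f_def using integrable_cauchy[OF g, of "z + of_real t * v"]
    by (intro integrable_scaleR_right integrable_Re integrable_mult_right) 
  have fm: "(\<lambda>(t, y). f t y) \<in> borel_measurable (lborel \<Otimes>\<^sub>M lborel)"
    unfolding f_def by measurable
  have fb: "(LINT y|lborel. norm (f t y)) \<le> norm v * K * indicator {0..1} t" for t
  proof (cases "t \<in> {0..1}")
    case True
    let ?u = "z + of_real t * v"
    have iN: "integrable lborel (\<lambda>y. Re (?N (?u - y) * ?g y))"
      by (intro integrable_Re integrable_potential[OF N g])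
    have "(LINT y|lborel. norm (f t y)) \<le> (LINT y|lborel. norm v * Re (?N (?u - y) * ?g y))"
    proof (intro integral_mono integrable_norm fi integrable_mult_right iN)
      fix y
      have "norm (f t y) \<le> norm (v * (inverse (?u - y) * ?g y))"
        unfolding f_def indicator_simps(1)[OF True] scaleR_one real_norm_def by (rule abs_Re_le_cmod)
      also have "\<dots> = norm v * Re (?N (?u - y) * ?g y)"
        by (cases "y \<in> A") (simp_all add: norm_mult norm_inverse del: of_real_inverse)
      finally show "norm (f t y) \<le> norm v * Re (?N (?u - y) * ?g y)" .
    qed
    also have "\<dots> = norm v * Re (potential ?N ?g ?u)"
      unfolding potential_def integral_Re[OF integrable_potential[OF N g, of ?u], symmetric]
      by (rule integral_mult_right_zero)
    also have "\<dots> \<le> norm v * K"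
      using K[of t] True complex_Re_le_cmod[of "potential ?N ?g ?u"] by (intro mult_left_mono) auto
    finally show ?thesis using True by simp
  qed (simp add: f_def)
  have fint: "integrable (lborel \<Otimes>\<^sub>M lborel) (\<lambda>(t, y). f t y)"
  proof (rule lborel_pair.Fubini_integrable[OF fm])
    show "AE t in lborel. integrable lborel (\<lambda>y. (\<lambda>(t, y). f t y) (t, y))"
      using fi by simp
    show "integrable lborel (\<lambda>t. LINT y|lborel. norm ((\<lambda>(t, y). f t y) (t, y)))"
    proof (rule Bochner_Integration.integrable_bound)
      show "integrable lborel (\<lambda>t::real. norm v * K * indicator {0..1} t)"
        by (intro integrable_mult_right integrable_real_indicator) auto
      show "(\<lambda>t. LINT y|lborel. norm ((\<lambda>(t, y). f t y) (t, y))) \<in> borel_measurable lborel"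
        using fm by measurable
      show "AE t in lborel. norm (LINT y|lborel. norm ((\<lambda>(t, y). f t y) (t, y))) \<le> norm (norm v * K * indicator {0..1} t)"
      proof (intro AE_I2)
        fix t
        have "(LINT y|lborel. norm (f t y)) \<ge> 0" by simp
        then show "norm (LINT y|lborel. norm ((\<lambda>(t, y). f t y) (t, y))) \<le> norm (norm v * K * indicator {0..1} t)"
          using fb[of t] by (simp only: prod.case real_norm_def abs_of_nonneg)
      qed
    qed
  qed
  have "Re (potential log_kernel ?g (z + v)) - Re (potential log_kernel ?g z)
      = (LINT y|lborel. Re (log_kernel (z + v - y) * ?g y) - Re (log_kernel (z - y) * ?g y))"
    unfolding potential_def integral_Re[OF integrable_potential[OF weak_kernel_ln g], symmetric]
    by (intro Bochner_Integration.integral_diff[symmetric] integrable_Re integrable_potential[OF weak_kernel_ln g])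
  also have "\<dots> = (LINT y|lborel. (LINT t|lborel. f t y))"
  proof (rule integral_cong_AE)
    show "(\<lambda>y. LINT t|lborel. f t y) \<in> borel_measurable lborel"
      using lborel_pair.integrable_snd[OF fint] by simp
    show "(\<lambda>y. Re (log_kernel (z + v - y) * ?g y) - Re (log_kernel (z - y) * ?g y)) \<in> borel_measurable lborel"
      by measurable
    show "AE y in lborel. Re (log_kernel (z + v - y) * ?g y) - Re (log_kernel (z - y) * ?g y) = (LINT t|lborel. f t y)"
      using AE_lborel_not_in_segment[of z "z + v"]
    proof eventually_elim
      case (elim y)
      have "(z - y) + of_real t * v \<noteq> 0" if "0 \<le> t" "t \<le> 1" for t :: real
      proof
        assume "(z - y) + of_real t * v = 0"
        then have "y = (1 - t) *\<^sub>R z + t *\<^sub>R (z + v)" by (simp add: algebra_simps scaleR_conv_of_real)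
        with elim that show False by (auto simp: closed_segment_def)
      qed
      from ln_norm_along_segment[OF this]
      have *: "(LINT t|lborel. indicator {0..1} t *\<^sub>R Re (v * inverse (z - y + of_real t * v))) = ln (norm (z - y + v)) - ln (norm (z - y))" .
      show ?case
      proof (cases "y \<in> A")
        case True
        then show ?thesis using * by (simp add: f_def algebra_simps)
      qed (simp add: f_def)
    qed
  qed
  also have "\<dots> = (LINT t|lborel. (LINT y|lborel. f t y))"
    by (rule lborel_pair.Fubini_integral[OF fint])
  also have "\<dots> = (LINT t|lborel. indicator {0..1} t *\<^sub>R Re (v * cauchy_transform ?g (z + of_real t * v)))"
  proof (rule Bochner_Integration.integral_cong[OF refl])
    fix t :: real
    have "(LINT y|lborel. f t y) = indicator {0..1} t *\<^sub>R (LINT y|lborel. Re (v * (inverse (z + of_real t * v - y) * ?g y)))"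
      unfolding f_def by (rule integral_scaleR_right)
    also have "(LINT y|lborel. Re (v * (inverse (z + of_real t * v - y) * ?g y))) = Re (LINT y|lborel. v * (inverse (z + of_real t * v - y) * ?g y))"
      using integrable_cauchy[OF g] by (intro integral_Re integrable_mult_right)
    also have "(LINT y|lborel. v * (inverse (z + of_real t * v - y) * ?g y)) = v * cauchy_transform ?g (z + of_real t * v)"
      unfolding potential_def by (rule integral_mult_right_zero)
    finally show "(LINT y|lborel. f t y) = indicator {0..1} t *\<^sub>R Re (v * cauchy_transform ?g (z + of_real t * v))" .
  qed
  finally show ?thesis .
qed

text \<open>Freezing the Cauchy transform at \<open>z\<close> in the increment formula costs at most
  |v| times its oscillation along the segment, which is small by continuity.\<close>

lemma log_potential_has_derivative:
  assumes A: "A \<in> sets borel" "bounded A"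
  shows "((\<lambda>z. Re (potential log_kernel (indicator A) z)) has_derivative
    (\<lambda>v. Re (v * cauchy_transform (indicator A) z))) (at z)"
  unfolding has_derivative_at_alt
proof (intro conjI allI impI)
  let ?F = "cauchy_transform (indicator A)"
  let ?U = "\<lambda>z. Re (potential log_kernel (indicator A) z)"
  have cont: "continuous_on UNIV ?F" by (rule continuous_cauchy[OF bdd_density_indicator[OF A]])
  show "bounded_linear (\<lambda>v. Re (v * ?F z))"
    by (intro bounded_linear_compose[OF bounded_linear_Re] bounded_linear_mult_left)
  fix e :: real assume e: "e > 0"
  have "isCont ?F z" using cont by (simp add: continuous_on_eq_continuous_at)
  then obtain d where d: "d > 0" "\<And>w. dist w z < d \<Longrightarrow> dist (?F w) (?F z) < e"
    unfolding continuous_at_eps_delta using e by blast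
  have "norm (?U y - ?U z - Re ((y - z) * ?F z)) \<le> e * norm (y - z)" if y: "norm (y - z) < d" for y
  proof -
    define v where "v = y - z"
    have yz: "y = z + v" by (simp add: v_def)
    let ?h = "\<lambda>t. Re (v * ?F (z + of_real t * v))"
    have ch: "continuous_on {0..1} ?h"
      by (intro continuous_intros continuous_on_compose2[OF cont]) auto
    have i1: "integrable lborel (\<lambda>t. indicator {0..1} t *\<^sub>R ?h t)"
      using borel_integrable_atLeastAtMost'[OF ch] by (simp add: set_integrable_def)
    have i2: "integrable lborel (\<lambda>t::real. indicator {0..1} t *\<^sub>R Re (v * ?F z))"
      by (intro integrable_scaleR_left integrable_real_indicator) auto
    have "?U y - ?U z - Re (v * ?F z) = (LINT t|lborel. indicator {0..1} t *\<^sub>R ?h t) - (LINT t|lborel. indicator {0..1::real} t *\<^sub>R Re (v * ?F z))"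
      unfolding yz log_potential_increment[OF A] by simp
    also have "\<dots> = (LINT t|lborel. indicator {0..1} t *\<^sub>R ?h t - indicator {0..1} t *\<^sub>R Re (v * ?F z))"
      using i1 i2 by simp
    also have "norm \<dots> \<le> (LINT t|lborel. (norm v * e) * indicator {0..1::real} t)"
    proof (rule Bochner_Integration.integral_norm_bound_integral)
      show "integrable lborel (\<lambda>t::real. (norm v * e) * indicator {0..1} t)"
        by (intro integrable_mult_right integrable_real_indicator) auto
      fix t :: real
      show "norm (indicator {0..1} t *\<^sub>R ?h t - indicator {0..1} t *\<^sub>R Re (v * ?F z)) \<le> (norm v * e) * indicator {0..1} t"
      proof (cases "t \<in> {0..1}")
        case True
        have "norm (of_real t * v) \<le> norm v" using True by (simp add: norm_mult mult_left_le_one_le)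
        then have "dist (z + of_real t * v) z < d" using y by (simp add: dist_norm v_def)
        then have "norm (?F (z + of_real t * v) - ?F z) \<le> e" using d by (simp add: dist_norm less_imp_le)
        then have "norm (v * (?F (z + of_real t * v) - ?F z)) \<le> norm v * e"
          by (simp add: norm_mult mult_left_mono)
        moreover have "\<bar>?h t - Re (v * ?F z)\<bar> \<le> norm (v * (?F (z + of_real t * v) - ?F z))"
          using abs_Re_le_cmod[of "v * (?F (z + of_real t * v) - ?F z)"] by (simp add: right_diff_distrib)
        ultimately show ?thesis using True by simp
      qed simp
    qed (use i1 i2 in auto)
    also have "\<dots> = e * norm v" by simp
    finally show ?thesis by (simp add: v_def)
  qed
  then show "\<exists>d>0. \<forall>y. norm (y - z) < d \<longrightarrow> norm (?U y - ?U z - Re ((y - z) * ?F z)) \<le> e * norm (y - z)"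
    using d by blast
qed

section \<open>Rotating patches with angular velocity one half\<close>

lemma stream_fun_eq_potential:
  assumes A: "A \<in> sets borel" "bounded A"
  shows "stream_fun A x = Re (potential log_kernel (indicator A) x) / (2 * pi)"
proof -
  note i = integrable_potential[OF weak_kernel_ln bdd_density_indicator[OF A], of x]
  have eq: "Re (log_kernel (x - y) * indicator A y) = indicator A y *\<^sub>R ln (norm (x - y))" for y
    by (simp add: indicator_def)
  have "integrable lborel (\<lambda>y. Re (log_kernel (x - y) * indicator A y))"
    using i by (rule integrable_Re)
  then have "set_integrable lborel A (\<lambda>y. ln (norm (x - y)))"
    unfolding eq set_integrable_def .
  then have "integral A (\<lambda>y. ln (norm (x - y))) = (LINT y:A|lborel. ln (norm (x - y)))"
    by (rule set_borel_integral_eq_integral(2)[symmetric])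
  also have "\<dots> = (LINT y|lborel. Re (log_kernel (x - y) * indicator A y))"
    unfolding eq set_lebesgue_integral_def ..
  also have "\<dots> = Re (potential log_kernel (indicator A) x)"
    unfolding potential_def using i by (rule integral_Re)
  finally show ?thesis by (simp add: stream_fun_def)
qed

lemma cauchy_transform_inside:
  fixes D :: "complex set"
  assumes D: "open D" "D \<noteq> {}" "bounded D" "simply_connected D"
    and bc: "\<And>x. x \<in> frontier D \<Longrightarrow> stream_fun D x - (1/4) * (norm x)\<^sup>2 = \<mu>"
    and z: "z \<in> D"
  shows "cauchy_transform (indicator D) z = of_real pi * cnj z"
proof -
  have B: "D \<in> sets borel" using D by simp
  note g = bdd_density_indicator[OF B D(3)]
  have conn: "connected D" using D(4) by (rule simply_connected_imp_connected)
  define F where "F = cauchy_transform (indicator D)"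
  define U where "U = (\<lambda>x. Re (potential log_kernel (indicator D) x))"
  \<comment> \<open>Scaling by \<open>2 * pi\<close> clears the normalisation of
    \<open>stream_fun\<close>, whence \<open>pi / 2\<close> = 2 * pi * (1/4). The derivative then
    becomes exactly \<open>Re (v * H x)\<close>, so \<open>h\<close> is locally the real part of a
    primitive of \<open>H\<close>.\<close>
  define h where "h = (\<lambda>x. U x - pi / 2 * (norm x)\<^sup>2)"
  define H where "H = (\<lambda>x. F x - of_real pi * cnj x)"
  have hh: "h x = 2 * pi * (stream_fun D x - (1/4) * (norm x)\<^sup>2)" for x
    by (simp add: h_def U_def stream_fun_eq_potential[OF B D(3)] field_simps)
  have ch: "continuous_on UNIV h"
    unfolding h_def U_def by (intro continuous_intros continuous_potential[OF weak_kernel_ln g])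
  have "H holomorphic_on D"
    unfolding H_def F_def by (rule cauchy_transform_open_set_holomorphic[OF D(1) D(3)])
  then obtain P where P: "\<And>x. x \<in> D \<Longrightarrow> (P has_field_derivative H x) (at x)"
    using D(4) simply_connected_eq_global_primitive[OF D(1)] by blast
  have dh: "(h has_derivative (\<lambda>v. Re (v * H x))) (at x)" for x
  proof -
    have "((\<lambda>x::complex. (norm x)\<^sup>2) has_derivative (\<lambda>v. 2 * Re (v * cnj x))) (at x)"
      unfolding power2_norm_eq_inner
      by (auto intro!: derivative_eq_intros simp: inner_complex_def algebra_simps)
    then have "(h has_derivative (\<lambda>v. Re (v * F x) - pi / 2 * (2 * Re (v * cnj x)))) (at x)"
      unfolding h_def U_def F_def
      by (intro has_derivative_diff log_potential_has_derivative[OF B D(3)] has_derivative_mult_right)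
    also have "(\<lambda>v. Re (v * F x) - pi / 2 * (2 * Re (v * cnj x))) = (\<lambda>v. Re (v * H x))"
      by (auto simp: H_def algebra_simps)
    finally show ?thesis .
  qed
  have "\<exists>c. \<forall>x\<in>D. h x - Re (P x) = c"
  proof -
    have "(\<lambda>x. h x - Re (P x)) constant_on D"
    proof (rule has_derivative_zero_connected_constant_on[OF conn D(1), of "{}"])
      have der: "((\<lambda>x. h x - Re (P x)) has_derivative (\<lambda>v. 0)) (at x)" if x: "x \<in> D" for x
      proof -
        have "(P has_derivative (\<lambda>v. H x * v)) (at x)"
          using P[OF x] by (simp add: has_field_derivative_def)
        from has_derivative_diff[OF dh[of x] bounded_linear.has_derivative[OF bounded_linear_Re this]]
        show ?thesis by (simp add: mult.commute)
      qed
      then show "\<forall>x\<in>D - {}. ((\<lambda>x. h x - Re (P x)) has_derivative (\<lambda>v. 0)) (at x within D)"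
        by (auto intro: has_derivative_at_withinI)
      show "continuous_on D (\<lambda>x. h x - Re (P x))"
        using der by (auto intro!: continuous_at_imp_continuous_on has_derivative_continuous)
    qed auto
    then show ?thesis by (auto simp: constant_on_def)
  qed
  then obtain c where c: "\<And>x. x \<in> D \<Longrightarrow> h x = Re (P x) + c"
    by (metis diff_eq_eq add.commute)
  have fr: "h x = 2 * pi * \<mu>" if "x \<in> frontier D" for x
    using bc[OF that] by (simp add: hh)
  \<comment> \<open>If maximum and minimum over the closure both lie on the frontier, they share the
    boundary value and \<open>h\<close> is constant; otherwise one of them is attained in
    \<open>D\<close>.\<close>
  have "\<exists>x\<in>D. (\<forall>y\<in>D. h y \<le> h x) \<or> (\<forall>y\<in>D. h x \<le> h y)"
  proof -
    have cl: "compact (closure D)" "closure D \<noteq> {}" using D by auto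
    have chc: "continuous_on (closure D) h" using ch continuous_on_subset by blast
    obtain a where a: "a \<in> closure D" "\<And>y. y \<in> closure D \<Longrightarrow> h y \<le> h a"
      using continuous_attains_sup[OF cl chc] by blast
    obtain b where b: "b \<in> closure D" "\<And>y. y \<in> closure D \<Longrightarrow> h b \<le> h y"
      using continuous_attains_inf[OF cl chc] by blast
    have sub: "D \<subseteq> closure D" by (rule closure_subset)
    have fd: "frontier D = closure D - D" using D(1) by (simp add: frontier_def interior_open)
    consider "a \<in> D" | "b \<in> D" | "a \<in> frontier D" "b \<in> frontier D" using a b fd by blast
    then show ?thesis
    proof cases
      case 3
      then have "h y = 2 * pi * \<mu>" if "y \<in> D" for y
        using a(2)[of y] b(2)[of y] fr[of a] fr[of b] that sub by force
      then show ?thesis using z by auto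
    qed (use a b sub in blast)+
  qed
  \<comment> \<open>The sign \<open>s\<close> treats an interior minimum as a maximum of
    \<open>- h\<close>.\<close>
  then obtain x s where x: "x \<in> D" and s: "s = 1 \<or> s = (-1::real)" "\<And>y. y \<in> D \<Longrightarrow> s * h y \<le> s * h x"
    by (metis mult_1 mult_minus1 neg_le_iff_le)
  have Pd: "((\<lambda>w. exp (of_real s * P w)) has_field_derivative exp (of_real s * P y) * (of_real s * H y)) (at y)" if "y \<in> D" for y
    using P[OF that] by (auto intro!: derivative_eq_intros)
  \<comment> \<open>The modulus of this function is exp (s * Re P), and Re P is \<open>h\<close> up
    to a constant, so the modulus is maximal at the interior point \<open>x\<close>.\<close>
  have "(\<lambda>w. exp (of_real s * P w)) constant_on D"
  proof (rule maximum_modulus_principle[OF _ D(1) conn D(1) subset_refl x])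
    show "(\<lambda>w. exp (of_real s * P w)) holomorphic_on D"
      using Pd by (auto simp: holomorphic_on_open[OF D(1)])
    show "norm (exp (of_real s * P y)) \<le> norm (exp (of_real s * P x))" if "y \<in> D" for y
      using s(2)[OF that] c[OF that] c[OF x] by (simp add: norm_exp_eq_Re algebra_simps)
  qed
  then obtain k where k: "\<And>y. y \<in> D \<Longrightarrow> exp (of_real s * P y) = k" by (auto simp: constant_on_def)
  have "((\<lambda>w. exp (of_real s * P w)) has_field_derivative 0) (at z)"
    by (rule has_field_derivative_transform_within_open[of "\<lambda>_. k" _ _ D]) (use D z k in auto)
  then have "exp (of_real s * P z) * (of_real s * H z) = 0"
    using Pd[OF z] DERIV_unique by blast
  then have "H z = 0" using s(1) by auto
  then show ?thesis by (simp add: H_def F_def)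
qed

lemma patch_measure:
  fixes D :: "complex set"
  assumes D: "open D" "D \<noteq> {}" "bounded D"
    and F: "\<And>z. z \<in> D \<Longrightarrow> cauchy_transform (indicator D) z = of_real pi * cnj z"
  obtains M where "M > 0" "D \<subseteq> ball 0 M" "measure lborel D = pi * M\<^sup>2"
proof -
  have B: "D \<in> sets borel" using D by simp
  note g = bdd_density_indicator[OF B D(3)]
  define G where "G = (\<lambda>z. z * cauchy_transform (indicator D) z)"
  have cG: "continuous_on UNIV G" unfolding G_def by (intro continuous_intros continuous_cauchy g)
  define E where "E = - closure D"
  have oE: "open E" by (simp add: E_def open_Compl)
  have hG: "G holomorphic_on E"
    unfolding G_def using closure_subset[of D]
    by (intro holomorphic_intros cauchy_transform_holomorphic g oE) (auto simp: E_def indicator_def)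
  have GD: "G z = of_real (pi * (norm z)\<^sup>2)" if z: "z \<in> closure D" for z
  proof -
    have "cauchy_transform (indicator D) z - of_real pi * cnj z = 0"
      by (rule continuous_constant_on_closure[where S = D, OF _ _ z])
         (auto intro!: continuous_intros continuous_on_subset[OF continuous_cauchy[OF g]] simp: F)
    then have "G z = of_real pi * (z * cnj z)" by (simp add: G_def)
    then show ?thesis unfolding complex_norm_square[symmetric] by simp
  qed
  define m where "m = measure lborel D"
  have lim: "(G \<longlongrightarrow> of_real m) at_infinity"
    unfolding G_def m_def integral_indicator_complex[OF B D(3), symmetric]
    by (rule cauchy_transform_at_infinity[OF g])
  \<comment> \<open>\<open>G\<close> is real on the boundary and at infinity, so the maximum principle applies to \<open>exp (\<plusminus> \<i> G)\<close>.\<close>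
  have ImG: "Im (G z) = 0" if z: "z \<in> E" for z
  proof -
    have small: "s * Im (G z) \<le> e" if e: "e > 0" and s: "s = 1 \<or> s = (-1::real)" for e s
    proof -
      have "((\<lambda>z. Im (G z)) \<longlongrightarrow> Im (of_real m)) at_infinity" by (intro tendsto_intros lim)
      then have "\<forall>\<^sub>F z in at_infinity. dist (Im (G z)) 0 < e" using e by (auto dest: tendstoD)
      then obtain R0 where R0: "\<And>u. norm u \<ge> R0 \<Longrightarrow> \<bar>Im (G u)\<bar> < e"
        by (auto simp: eventually_at_infinity)
      \<comment> \<open>The maximum modulus principle requires a bounded set, so \<open>E\<close> is
        truncated by a disc that contains \<open>z\<close> and is so large that \<open>Im G\<close>
        is below \<open>e\<close> in modulus on its bounding circle.\<close>
      define R where "R = max R0 (norm z + 1)"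
      define f where "f = (\<lambda>u. exp (- \<i> * of_real s * G u))"
      have nf: "norm (f u) = exp (s * Im (G u))" for u by (simp add: f_def norm_exp_eq_Re)
      have "norm (f z) \<le> exp e"
      proof (rule maximum_modulus_frontier[where f = f and \<xi> = z and S = "E \<inter> ball 0 R"])
        show "f holomorphic_on interior (E \<inter> ball 0 R)"
          unfolding f_def using hG oE
          by (intro holomorphic_intros) (auto simp: interior_open open_Int intro: holomorphic_on_subset)
        show "continuous_on (closure (E \<inter> ball 0 R)) f"
          unfolding f_def by (intro continuous_intros continuous_on_subset[OF cG]) auto
        show "bounded (E \<inter> ball 0 R)" by (auto intro: bounded_subset[OF bounded_ball])
        show "z \<in> E \<inter> ball 0 R" using z by (auto simp: R_def)
        fix u assume u: "u \<in> frontier (E \<inter> ball 0 R)"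
        have "R > 0" unfolding R_def using norm_ge_zero[of z] by linarith
        have "frontier (E \<inter> ball 0 R) \<subseteq> frontier E \<union> frontier (ball 0 R)"
          using frontier_Int_subset[of E "ball 0 R"] by blast
        then consider "u \<in> frontier E" | "norm u = R"
          using u frontier_ball[OF \<open>R > 0\<close>, of "0::complex"] by (auto simp: sphere_def)
        then have "s * Im (G u) \<le> e"
        proof cases
          case 1
          then have "u \<notin> E" using oE by (simp add: frontier_def interior_open)
          then have "u \<in> closure D" by (simp add: E_def)
          then show ?thesis using GD e by simp
        next
          case 2
          then have "\<bar>Im (G u)\<bar> < e" by (intro R0) (simp add: R_def)
          then show ?thesis using s by auto
        qed
        then show "norm (f u) \<le> exp e" by (simp add: nf)
      qed
      then show ?thesis by (simp add: nf)
    qed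
    have "Im (G z) \<le> 0" by (rule field_le_epsilon) (use small[of _ 1] in simp)
    moreover have "- Im (G z) \<le> 0" by (rule field_le_epsilon) (use small[of _ "-1"] in simp)
    ultimately show ?thesis by simp
  qed
  have "compact (closure D)" "closure D \<noteq> {}" using D by auto
  then obtain p where p: "p \<in> closure D" "\<And>y. y \<in> closure D \<Longrightarrow> norm y \<le> norm p"
    using continuous_attains_sup[of "closure D" norm] by (auto intro: continuous_intros)
  define M where "M = norm p"
  have sub: "D \<subseteq> cball 0 M" using p(2) closure_subset[of D] by (auto simp: M_def)
  \<comment> \<open>An open set inside the closed disc lies in its interior.\<close>
  then have sub': "D \<subseteq> ball 0 M" using interior_maximal[OF sub D(1)] by simp
  then have "ball (0::complex) M \<noteq> {}" using D by blast
  then have M: "M > 0" by (simp add: not_le)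
  \<comment> \<open>This part of \<open>E\<close> is connected, reaches infinity and has
    \<open>p\<close> in its closure, so one constant value of \<open>G\<close> links the area to
    \<open>p\<close>.\<close>
  let ?S = "- cball (0::complex) M"
  have SE: "?S \<subseteq> E" using p(2) by (auto simp: E_def M_def)
  \<comment> \<open>As \<open>G\<close> is real on \<open>?S\<close>, this function has modulus 1
    there, and every point is a maximum of the modulus. Differentiating the resulting constant gives
    G' = 0.\<close>
  have "(\<lambda>u. exp (\<i> * G u)) constant_on ?S"
  proof (rule maximum_modulus_principle[where U = ?S and \<xi> = "of_real (M + 1)"])
    show "(\<lambda>u. exp (\<i> * G u)) holomorphic_on ?S"
      by (intro holomorphic_intros holomorphic_on_subset[OF hG SE])
    show "connected ?S" by (intro connected_complement_bounded_convex) auto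
    have in_S: "of_real (M + 1) \<in> ?S" using M by (simp del: of_real_add)
    then show "of_real (M + 1) \<in> ?S" .
    show "norm (exp (\<i> * G u)) \<le> norm (exp (\<i> * G (of_real (M + 1))))" if "u \<in> ?S" for u
    proof -
      have "Im (G u) = 0" "Im (G (of_real (M + 1))) = 0" using ImG that in_S SE by blast+
      then show ?thesis by simp
    qed
  qed auto
  then obtain k where k: "\<And>u. u \<in> ?S \<Longrightarrow> exp (\<i> * G u) = k" by (auto simp: constant_on_def)
  have "G constant_on ?S"
  proof (rule has_field_derivative_0_imp_constant_on)
    fix u assume u: "u \<in> ?S"
    obtain d where d: "(G has_field_derivative d) (at u)"
      using hG u SE oE holomorphic_on_open by blast
    then have "((\<lambda>u. exp (\<i> * G u)) has_field_derivative exp (\<i> * G u) * (\<i> * d)) (at u)"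
      by (auto intro!: derivative_eq_intros)
    moreover have "((\<lambda>u. exp (\<i> * G u)) has_field_derivative 0) (at u)"
      by (rule has_field_derivative_transform_within_open[of "\<lambda>_. k" _ _ ?S]) (use u k in auto)
    ultimately have "exp (\<i> * G u) * (\<i> * d) = 0" using DERIV_unique by blast
    then show "(G has_field_derivative 0) (at u)" using d by simp
  qed (auto intro: connected_complement_bounded_convex)
  then obtain l where l: "\<And>u. u \<in> ?S \<Longrightarrow> G u = l" by (auto simp: constant_on_def)
  have "(G \<longlongrightarrow> l) at_infinity"
    by (rule tendsto_eventually) (auto simp: eventually_at_infinity intro!: exI[of _ "M + 1"] l)
  then have "l = of_real m" using lim tendsto_unique[OF trivial_limit_at_infinity] by blast
  \<comment> \<open>\<open>p\<close> is approached from outside the disc here, whereas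
    \<open>GD\<close> evaluates \<open>G p\<close> through the closure of \<open>D\<close>;
    comparing the two values yields the area.\<close>
  moreover have "G p = l"
    using l continuous_constant_on_closure[of ?S G l p] continuous_on_subset[OF cG, of "closure ?S"]
    by (auto simp: closure_complement M_def)
  ultimately have "of_real m = complex_of_real (pi * M\<^sup>2)" using GD[OF p(1)] by (simp add: M_def)
  then have "m = pi * M\<^sup>2" by (simp only: of_real_eq_iff)
  then show ?thesis using that[OF M sub'] by (simp add: m_def)
qed

text \<open>The \<open>C\<^sup>1\<close> condition excludes slits: near a boundary point the complement of \<open>D\<close>
  has positive measure.\<close>
lemma full_measure_C1_ball:
  fixes D :: "complex set"
  assumes D: "open D" "D \<noteq> {}" "C1_boundary D" "D \<subseteq> ball 0 M" "measure lborel D = pi * M\<^sup>2" and M: "M > 0"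
  shows "D = ball 0 M"
proof (rule ccontr)
  assume "D \<noteq> ball 0 M"
  then have "ball 0 M - D \<noteq> {}" using D by blast
  moreover have "ball 0 M \<inter> D \<noteq> {}" using D by blast
  \<comment> \<open>A connected disc meeting both \<open>D\<close> and its complement meets the
    frontier.\<close>
  ultimately have "ball 0 M \<inter> frontier D \<noteq> {}" by (intro connected_Int_frontier) auto
  then obtain p where p: "p \<in> ball 0 M" "p \<in> frontier D" by blast
  obtain r \<theta> f where r: "r > 0" and f: "f C1_differentiable_on UNIV" "f 0 = 0"
    and eq: "D \<inter> ball p r = {x \<in> ball p r. Im (cis \<theta> * (x - p)) < f (Re (cis \<theta> * (x - p)))}"
    using D(3) p(2) unfolding C1_boundary_def by blast
  have cf: "continuous_on UNIV f"
    using C1_differentiable_imp_continuous_on[OF f(1)] .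
  \<comment> \<open>The region strictly above the graph, within both discs: it is open and misses
    \<open>D\<close>.\<close>
  define W where "W = {x. f (Re (cis \<theta> * (x - p))) < Im (cis \<theta> * (x - p))} \<inter> (ball p r \<inter> ball 0 M)"
  have "open W" unfolding W_def
    by (intro open_Int open_ball open_Collect_less continuous_intros continuous_on_compose2[OF cf]) auto
  obtain s where s: "s > 0" "ball p s \<subseteq> ball p r \<inter> ball 0 M"
    using p r openE[of "ball p r \<inter> ball 0 M" p] by auto
  \<comment> \<open>In the rotated coordinates \<open>q\<close> lies at height \<open>s/2\<close>
    straight above \<open>p\<close>, hence above the graph because \<open>f 0 = 0\<close>.\<close>
  define q where "q = p + cis (- \<theta>) * (\<i> * of_real (s/2))"
  have "cis \<theta> * (q - p) = \<i> * of_real (s/2)"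
    by (simp add: q_def mult.assoc[symmetric] cis_mult)
  then have "f (Re (cis \<theta> * (q - p))) < Im (cis \<theta> * (q - p))"
    using s f(2) by (simp only:) simp
  moreover have "q \<in> ball p s" using s by (simp add: q_def dist_norm norm_mult)
  ultimately have "q \<in> W" unfolding W_def using s(2) by blast
  then obtain e where e: "e > 0" "ball q e \<subseteq> W" using \<open>open W\<close> openE by blast
  have "False" if x: "x \<in> W" "x \<in> D" for x
  proof -
    have "x \<in> D \<inter> ball p r" using x unfolding W_def by blast
    then have "Im (cis \<theta> * (x - p)) < f (Re (cis \<theta> * (x - p)))" unfolding eq by blast
    moreover have "f (Re (cis \<theta> * (x - p))) < Im (cis \<theta> * (x - p))" using x(1) unfolding W_def by blast
    ultimately show False by (rule less_asym)
  qed
  then have WD: "W \<inter> D = {}" by blast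
  \<comment> \<open>A disc of positive area in \<open>ball 0 M\<close>, disjoint from
    \<open>D\<close>, is incompatible with \<open>D\<close> already having the full area
    \<open>pi * M\<^sup>2\<close>.\<close>
  have "measure lborel (ball q e \<union> D) = measure lborel (ball q e) + measure lborel D"
  proof (rule measure_Union)
    have "bounded D" using D(4) bounded_ball bounded_subset by blast
    then show "emeasure lborel D \<noteq> \<infinity>" using emeasure_bounded_finite by fastforce
    show "emeasure lborel (ball q e) \<noteq> \<infinity>" using emeasure_lborel_ball_finite[of q e] by simp
    show "ball q e \<inter> D = {}" using e WD by blast
  qed (use D in auto)
  moreover have "measure lborel (ball q e \<union> D) \<le> measure lborel (ball (0::complex) M)"
  proof (rule measure_mono_fmeasurable)
    show "ball q e \<union> D \<subseteq> ball 0 M" using D(4) e(2) unfolding W_def by blast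
    show "ball (0::complex) M \<in> fmeasurable lborel"
      by (rule fmeasurableI) (auto simp: emeasure_lborel_ball_finite[unfolded infinity_ennreal_def])
  qed (use D in auto)
  moreover have "measure lborel (ball (0::complex) M) = pi * M\<^sup>2"
    using M by (simp add: content_ball unit_ball_vol_2)
  moreover have "measure lborel (ball q e) > 0" using e by (simp add: content_ball_pos)
  ultimately show False using D by linarith
qed

theorem theorem2:
  fixes D :: "complex set" and \<mu> :: real
  assumes "open D" and "D \<noteq> {}" and "connected D" and "bounded D" and "simply_connected D"
    and "C1_boundary D"
    and "barycenter_zero D"
    and "\<forall>x \<in> frontier D. stream_fun D x - (1/4) * (norm x)\<^sup>2 = \<mu>"
  shows "\<exists>c r. r > 0 \<and> D = ball c r"
proof -
  have "cauchy_transform (indicator D) z = of_real pi * cnj z" if "z \<in> D" for z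
    using cauchy_transform_inside assms that by blast
  then obtain M where M: "M > 0" "D \<subseteq> ball 0 M" "measure lborel D = pi * M\<^sup>2"
    using patch_measure assms by blast
  then have "D = ball 0 M" using full_measure_C1_ball assms by blast
  then show ?thesis using M by blast
qed

end
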